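(* Let $p$ be a prime and let $\phi:\mathbb{Q}_p\to\mathbb{Q}_p$ be a bijection such that the image and the inverse image of any ball are balls. Suppose that $\phi$ is continuously differentiable on $\mathbb{Q}_p$. Let $\alpha>0$, let $D^{\alpha}$ be the Vladimirov operator, and for $f:\mathbb{Q}_p\to\mathbb{C}$ let $\Phi f(x)=f(\phi(x))$. Then $$ D^{\alpha}(\Phi f)(x)=|\phi'(x)|_p^{\alpha}\,\bigl(\Phi (D^{\alpha}f)\bigr)(x)=|\phi'(x)|_p^{\alpha}\,(D^{\alpha}f)(\phi(x)) $$ for all $f:\mathbb{Q}_p\to\mathbb{C}$ and all $x\in\mathbb{Q}_p$ for which the integrals defining the two sides converge absolutely.
   Context: $|\cdot|_p$ is the $p$-adic norm on $\mathbb{Q}_p$. A ball is a set $\{x\in\mathbb{Q}_p:|x-a|_p\le p^{\gamma}\}$ with $a\in\mathbb{Q}_p$, $\gamma\in\mathbb{Z}$. The derivative is $\phi'(x)=\lim_{h\to 0}(\phi(x+h)-\phi(x))/h\in\mathbb{Q}_p$; continuously differentiable means that $\phi'$ exists everywhere and is continuous. For $\alpha>0$ the Vladimirov operator of $p$-adic fractional differentiation is $$ D^{\alpha} f(x)=c_{\alpha}\int_{\mathbb{Q}_p}\frac{f(x)-f(y)}{|x-y|_p^{1+\alpha}}\,dy,\qquad c_{\alpha}=\frac{p^{\alpha}-1}{1-p^{-1-\alpha}}, $$ where $dy$ is the Haar measure on $\mathbb{Q}_p$ normalized so that $\mathbb{Z}_p$ has measure one. *)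

theory Defs
  imports "HOL-Analysis.Analysis" "Berlekamp_Zassenhaus.Finite_Field"
begin

text \<open>
  The field \<open>\<rat>\<^sub>p\<close> is built as the completion of \<open>\<rat>\<close> with respect to the \<open>p\<close>-adic absolute value:
  Cauchy sequences of rationals modulo null sequences. The prime is carried by the type: for
  \<open>'p :: prime_card\<close> the prime is \<open>CARD('p)\<close>, and \<open>'p padic\<close> is the field \<open>\<rat>\<^sub>p\<close>.
\<close>

definition padic_abs :: "nat \<Rightarrow> rat \<Rightarrow> real" where
  "padic_abs p q = (if q = 0 then 0 else
     real p powi (int (multiplicity (int p) (snd (quotient_of q)))
                - int (multiplicity (int p) (fst (quotient_of q)))))"

lemma padic_abs_fraction:
  assumes "prime p" "a \<noteq> 0" "b \<noteq> 0"
  shows "padic_abs p (of_int a / of_int b) =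
    real p powi (int (multiplicity (int p) b) - int (multiplicity (int p) a))"
proof -
  define q where "q = (of_int a / of_int b :: rat)"
  obtain n d where nd: "quotient_of q = (n, d)" by force
  have d: "d > 0" using quotient_of_denom_pos[OF nd] .
  have q: "q = of_int n / of_int d" using quotient_of_div[OF nd] .
  have "q \<noteq> 0" using assms by (simp add: q_def)
  then have n: "n \<noteq> 0" using q by auto
  have "(of_int (a * d) :: rat) = of_int (n * b)"
    using q assms d n by (simp add: q_def field_simps)
  then have e: "a * d = n * b" by (simp only: of_int_eq_iff)
  have P: "prime_elem (int p)" using assms by simp
  have "multiplicity (int p) (a * d) = multiplicity (int p) a + multiplicity (int p) d"
    using P assms d by (simp add: prime_elem_multiplicity_mult_distrib)
  moreover have "multiplicity (int p) (n * b) = multiplicity (int p) n + multiplicity (int p) b"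
    using P assms n by (simp add: prime_elem_multiplicity_mult_distrib)
  ultimately have "int (multiplicity (int p) d) - int (multiplicity (int p) n)
      = int (multiplicity (int p) b) - int (multiplicity (int p) a)"
    using e by simp
  with \<open>q \<noteq> 0\<close> nd show ?thesis by (simp add: padic_abs_def flip: q_def)
qed

lemma padic_abs_0 [simp]: "padic_abs p 0 = 0"
  by (simp add: padic_abs_def)

lemma padic_abs_1 [simp]: "padic_abs p 1 = 1"
  by (simp add: padic_abs_def)

lemma padic_abs_nonneg [simp]: "padic_abs p q \<ge> 0"
  by (simp add: padic_abs_def)

lemma padic_abs_eq_0_iff [simp]: "prime p \<Longrightarrow> padic_abs p q = 0 \<longleftrightarrow> q = 0"
  by (auto simp: padic_abs_def)

lemma rat_fraction_cases:
  obtains a b where "q = (of_int a / of_int b :: rat)" "b \<noteq> 0"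
  by (metis quotient_of_div quotient_of_denom_pos less_irrefl surj_pair)

lemma padic_abs_mult:
  assumes "prime p"
  shows "padic_abs p (q * r) = padic_abs p q * padic_abs p r"
proof (cases "q = 0 \<or> r = 0")
  case False
  obtain a b where q: "q = of_int a / of_int b" "b \<noteq> 0" by (rule rat_fraction_cases)
  obtain c d where r: "r = of_int c / of_int d" "d \<noteq> 0" by (rule rat_fraction_cases)
  have nz: "a \<noteq> 0" "c \<noteq> 0" using False q r by auto
  have qr: "q * r = of_int (a * c) / of_int (b * d)" using q r by simp
  have P: "prime_elem (int p)" using assms by simp
  have p: "real p \<noteq> 0" using assms prime_gt_0_nat by simp
  show ?thesis
    unfolding qr using q r nz P
    by (simp only: q r padic_abs_fraction[OF assms] mult_eq_0_iff simp_thms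
          prime_elem_multiplicity_mult_distrib)
       (simp add: power_int_add[symmetric] p algebra_simps)
qed auto

lemma padic_abs_minus [simp]: "padic_abs p (- q) = padic_abs p q"
proof -
  have "quotient_of (- q) = (- fst (quotient_of q), snd (quotient_of q))"
    by (simp add: rat_uminus_code split_beta)
  moreover have "multiplicity (int p) (- a) = multiplicity (int p) a" for a
    using multiplicity_times_unit_right[of "-1" "int p" a] by simp
  ultimately show ?thesis by (simp add: padic_abs_def)
qed

lemma padic_abs_minus_commute: "padic_abs p (q - r) = padic_abs p (r - q)"
  by (metis minus_diff_eq padic_abs_minus)

lemma padic_abs_of_int_le_1: "prime p \<Longrightarrow> padic_abs p (of_int a) \<le> 1"
proof (cases "a = 0")
  case False
  assume p: "prime p"
  then have "padic_abs p (of_int a / of_int 1) = real p powi (- int (multiplicity (int p) a))"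
    using False by (subst padic_abs_fraction) auto
  also have "\<dots> \<le> 1"
    using prime_ge_1_nat[OF p] by (simp add: power_int_minus one_le_power inverse_le_1_iff)
  finally show ?thesis by simp
qed auto

lemma padic_abs_inverse: 
  assumes "prime p" shows "padic_abs p (inverse q) = inverse (padic_abs p q)"
proof (cases "q = 0")
  case False
  then have "padic_abs p q * padic_abs p (inverse q) = 1"
    using padic_abs_mult[OF assms, of q "inverse q"] by simp
  then show ?thesis by (metis inverse_unique)
qed auto

lemma padic_abs_add_le_max:
  assumes p: "prime p"
  shows "padic_abs p (q + r) \<le> max (padic_abs p q) (padic_abs p r)"
proof -
  have key: "padic_abs p (1 + t) \<le> 1" if t: "padic_abs p t \<le> 1" for t
  proof (cases "t = 0")
    case False
    obtain a b where q: "quotient_of t = (a, b)" by force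
    have b: "b > 0" using quotient_of_denom_pos[OF q] .
    have co: "coprime a b" using quotient_of_coprime[OF q] .
    have t_eq: "t = of_int a / of_int b" using quotient_of_div[OF q] .
    have a: "a \<noteq> 0" using t_eq False by auto
    have mb: "multiplicity (int p) b = 0"
    proof (rule ccontr)
      assume m: "multiplicity (int p) b \<noteq> 0"
      then have "int p dvd b" by (metis not_dvd_imp_multiplicity_0)
      then have "\<not> int p dvd a" using co p
        using coprime_common_divisor[of a b "int p"] prime_gt_1_nat[OF p] by auto
      then have "multiplicity (int p) a = 0" by (rule not_dvd_imp_multiplicity_0)
      then have "padic_abs p t = real p ^ multiplicity (int p) b"
        using False q by (simp add: padic_abs_def)
      moreover have "real p ^ multiplicity (int p) b > 1"
        using m prime_gt_1_nat[OF p] by (intro one_less_power) auto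
      ultimately show False using t by simp
    qed
    then have "padic_abs p (of_int b) = 1"
      using padic_abs_fraction[OF p, of b 1] b by simp
    moreover have "1 + t = of_int (a + b) * inverse (of_int b)"
      using t_eq b by (simp add: field_simps)
    ultimately have "padic_abs p (1 + t) = padic_abs p (of_int (a + b))"
      by (simp add: padic_abs_mult[OF p] padic_abs_inverse[OF p])
    then show ?thesis by (simp only: padic_abs_of_int_le_1[OF p])
  qed auto
  have wlog: "padic_abs p (q + r) \<le> padic_abs p r" if le: "padic_abs p q \<le> padic_abs p r" for q r
  proof (cases "r = 0")
    case True
    then show ?thesis using le by simp
  next
    case False
    have "padic_abs p (q * inverse r) \<le> 1"
      using le False padic_abs_nonneg[of p r] padic_abs_eq_0_iff[OF p, of r]
      by (simp only: padic_abs_mult[OF p] padic_abs_inverse[OF p])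
        (simp add: divide_le_eq_1 less_le flip: divide_inverse)
    from key[OF this] have *: "padic_abs p (1 + q * inverse r) \<le> 1" .
    have "q + r = r * (1 + q * inverse r)" using False by (simp add: field_simps)
    then have "padic_abs p (q + r) = padic_abs p r * padic_abs p (1 + q * inverse r)"
      by (simp add: padic_abs_mult[OF p])
    also have "\<dots> \<le> padic_abs p r * 1" using * by (intro mult_left_mono) auto
    finally show ?thesis by simp
  qed
  show ?thesis
    using wlog[of q r] wlog[of r q] by (auto simp: add.commute max_def)
qed

lemma padic_abs_triangle: "prime p \<Longrightarrow> padic_abs p (q + r) \<le> padic_abs p q + padic_abs p r"
  using padic_abs_add_le_max[of p q r] padic_abs_nonneg[of p q] padic_abs_nonneg[of p r] by linarith

lemma padic_abs_diff_abs:
  assumes "prime p" shows "\<bar>padic_abs p q - padic_abs p r\<bar> \<le> padic_abs p (q - r)"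
  using padic_abs_triangle[OF assms, of "q - r" r] padic_abs_triangle[OF assms, of "r - q" q]
    padic_abs_minus_commute[of p q r] by simp

definition padic_Cauchy :: "nat \<Rightarrow> (nat \<Rightarrow> rat) \<Rightarrow> bool" where
  "padic_Cauchy p X \<longleftrightarrow> (\<forall>e>0. \<exists>N. \<forall>m\<ge>N. \<forall>n\<ge>N. padic_abs p (X m - X n) < e)"

definition padic_null :: "nat \<Rightarrow> (nat \<Rightarrow> rat) \<Rightarrow> bool" where
  "padic_null p X \<longleftrightarrow> (\<lambda>n. padic_abs p (X n)) \<longlonglongrightarrow> 0"

lemma padic_null_le:
  "(\<And>n. padic_abs p (X n) \<le> f n) \<Longrightarrow> f \<longlonglongrightarrow> 0 \<Longrightarrow> padic_null p X"
  unfolding padic_null_def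
  by (rule tendsto_sandwich[of "\<lambda>_. 0" _ _ f]) (auto intro: always_eventually)

lemma padic_null_add:
  assumes "prime p" "padic_null p X" "padic_null p Y"
  shows "padic_null p (\<lambda>n. X n + Y n)"
  using tendsto_add[OF assms(2,3)[unfolded padic_null_def]]
  by (intro padic_null_le[where f = "\<lambda>n. padic_abs p (X n) + padic_abs p (Y n)"])
     (auto intro: padic_abs_triangle[OF assms(1)])

lemma padic_null_minus: "padic_null p X \<Longrightarrow> padic_null p (\<lambda>n. - X n)"
  by (simp add: padic_null_def)

lemma padic_null_diff:
  assumes "prime p" "padic_null p X" "padic_null p Y"
  shows "padic_null p (\<lambda>n. X n - Y n)"
  using padic_null_add[OF assms(1,2) padic_null_minus[OF assms(3)]] by simp

lemma padic_Cauchy_Cauchy_abs: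
  assumes p: "prime p" and X: "padic_Cauchy p X"
  shows "Cauchy (\<lambda>n. padic_abs p (X n))"
  unfolding Cauchy_def dist_real_def
  by (meson X[unfolded padic_Cauchy_def] padic_abs_diff_abs[OF p] le_less_trans)

lemma padic_Cauchy_convergent:
  assumes "prime p" "padic_Cauchy p X" shows "convergent (\<lambda>n. padic_abs p (X n))"
  using padic_Cauchy_Cauchy_abs[OF assms] by (rule Cauchy_convergent)

lemma padic_Cauchy_bounded:
  assumes "prime p" "padic_Cauchy p X"
  obtains K where "K > 0" "\<And>n. padic_abs p (X n) \<le> K"
proof -
  have "Bseq (\<lambda>n. padic_abs p (X n))"
    using padic_Cauchy_convergent[OF assms] by (rule convergent_imp_Bseq)
  then show ?thesis using that by (auto simp: Bseq_def)
qed

lemma padic_null_mult_left: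
  assumes p: "prime p" and X: "padic_Cauchy p X" and Y: "padic_null p Y"
  shows "padic_null p (\<lambda>n. X n * Y n)"
proof -
  obtain K where K: "K > 0" "\<And>n. padic_abs p (X n) \<le> K"
    using padic_Cauchy_bounded[OF p X] by blast
  show ?thesis
  proof (rule padic_null_le)
    show "padic_abs p (X n * Y n) \<le> K * padic_abs p (Y n)" for n
      using K by (simp add: padic_abs_mult[OF p] mult_right_mono)
    show "(\<lambda>n. K * padic_abs p (Y n)) \<longlonglongrightarrow> 0"
      using tendsto_mult_right_zero Y unfolding padic_null_def by blast
  qed
qed

lemma padic_Cauchy_const [simp]: "padic_Cauchy p (\<lambda>n. c)"
  by (simp add: padic_Cauchy_def)

lemma padic_null_0 [simp]: "padic_null p (\<lambda>n. 0)"
  by (simp add: padic_null_def)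

lemma padic_Cauchy_add:
  assumes p: "prime p" and X: "padic_Cauchy p X" and Y: "padic_Cauchy p Y"
  shows "padic_Cauchy p (\<lambda>n. X n + Y n)"
  unfolding padic_Cauchy_def
proof (intro allI impI)
  fix e :: real assume e: "e > 0"
  obtain M where M: "\<And>m n. m \<ge> M \<Longrightarrow> n \<ge> M \<Longrightarrow> padic_abs p (X m - X n) < e"
    using X e unfolding padic_Cauchy_def by blast
  obtain N where N: "\<And>m n. m \<ge> N \<Longrightarrow> n \<ge> N \<Longrightarrow> padic_abs p (Y m - Y n) < e"
    using Y e unfolding padic_Cauchy_def by blast
  have "padic_abs p (X m + Y m - (X n + Y n)) < e" if "m \<ge> max M N" "n \<ge> max M N" for m n
  proof -
    have "padic_abs p (X m + Y m - (X n + Y n)) = padic_abs p ((X m - X n) + (Y m - Y n))"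
      by (simp add: algebra_simps)
    then show ?thesis
      using padic_abs_add_le_max[OF p, of "X m - X n" "Y m - Y n"] M[of m n] N[of m n] that by simp
  qed
  then show "\<exists>N. \<forall>m\<ge>N. \<forall>n\<ge>N. padic_abs p (X m + Y m - (X n + Y n)) < e" by blast
qed

lemma padic_Cauchy_minus: "padic_Cauchy p X \<Longrightarrow> padic_Cauchy p (\<lambda>n. - X n)"
  unfolding padic_Cauchy_def minus_diff_minus padic_abs_minus by blast

lemma padic_Cauchy_mult:
  assumes p: "prime p" and X: "padic_Cauchy p X" and Y: "padic_Cauchy p Y"
  shows "padic_Cauchy p (\<lambda>n. X n * Y n)"
  unfolding padic_Cauchy_def
proof (intro allI impI)
  fix e :: real assume e: "e > 0"
  obtain K where K: "K > 0" "\<And>n. padic_abs p (X n) \<le> K"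
    using padic_Cauchy_bounded[OF p X] by blast
  obtain L where L: "L > 0" "\<And>n. padic_abs p (Y n) \<le> L"
    using padic_Cauchy_bounded[OF p Y] by blast
  have "e / L > 0" "e / K > 0" using e K L by auto
  obtain M where M: "\<And>m n. m \<ge> M \<Longrightarrow> n \<ge> M \<Longrightarrow> padic_abs p (X m - X n) < e / L"
    using X \<open>e / L > 0\<close> unfolding padic_Cauchy_def by blast
  obtain N where N: "\<And>m n. m \<ge> N \<Longrightarrow> n \<ge> N \<Longrightarrow> padic_abs p (Y m - Y n) < e / K"
    using Y \<open>e / K > 0\<close> unfolding padic_Cauchy_def by blast
  have "padic_abs p (X m * Y m - X n * Y n) < e" if mn: "m \<ge> max M N" "n \<ge> max M N" for m n
  proof -
    have "X m * Y m - X n * Y n = X m * (Y m - Y n) + (X m - X n) * Y n"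
      by (simp add: algebra_simps)
    then have "padic_abs p (X m * Y m - X n * Y n)
        \<le> max (padic_abs p (X m * (Y m - Y n))) (padic_abs p ((X m - X n) * Y n))"
      using padic_abs_add_le_max[OF p] by metis
    moreover have "padic_abs p (X m * (Y m - Y n)) < e"
    proof -
      have "padic_abs p (X m * (Y m - Y n)) \<le> K * padic_abs p (Y m - Y n)"
        using K by (simp add: padic_abs_mult[OF p] mult_right_mono)
      also have "\<dots> < K * (e / K)" using N[of m n] mn K(1) by (intro mult_strict_left_mono) auto
      finally show ?thesis using K(1) by simp
    qed
    moreover have "padic_abs p ((X m - X n) * Y n) < e"
    proof -
      have "padic_abs p ((X m - X n) * Y n) \<le> padic_abs p (X m - X n) * L"
        using L by (simp add: padic_abs_mult[OF p] mult_left_mono)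
      also have "\<dots> < (e / L) * L" using M[of m n] mn L(1) by (intro mult_strict_right_mono) auto
      finally show ?thesis using L(1) by simp
    qed
    ultimately show ?thesis by simp
  qed
  then show "\<exists>N. \<forall>m\<ge>N. \<forall>n\<ge>N. padic_abs p (X m * Y m - X n * Y n) < e" by blast
qed

lemma padic_Cauchy_not_null:
  assumes p: "prime p" and X: "padic_Cauchy p X" and nn: "\<not> padic_null p X"
  obtains b N where "b > 0" "\<And>n. n \<ge> N \<Longrightarrow> padic_abs p (X n) > b"
proof -
  obtain L where L: "(\<lambda>n. padic_abs p (X n)) \<longlonglongrightarrow> L"
    using padic_Cauchy_convergent[OF p X] by (auto simp: convergent_def)
  have "L \<ge> 0" by (rule tendsto_lowerbound[OF L]) auto
  moreover have "L \<noteq> 0" using L nn by (auto simp: padic_null_def)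
  ultimately have "L > 0" by simp
  then have "eventually (\<lambda>n. padic_abs p (X n) > L / 2) sequentially"
    by (intro order_tendstoD(1)[OF L]) simp
  then show ?thesis using that[of "L / 2"] \<open>L > 0\<close> by (auto simp: eventually_sequentially)
qed

lemma padic_abs_inverse_diff:
  assumes p: "prime p" and "x \<noteq> 0" "y \<noteq> 0"
  shows "padic_abs p (inverse x - inverse y) = padic_abs p (x - y) / (padic_abs p x * padic_abs p y)"
proof -
  have "inverse x - inverse y = (y - x) * inverse (x * y)"
    using assms by (simp add: field_simps)
  then show ?thesis
    using assms padic_abs_minus_commute[of p x y]
    by (simp add: padic_abs_mult padic_abs_inverse divide_inverse)
qed

lemma padic_Cauchy_inverse:
  assumes p: "prime p" and X: "padic_Cauchy p X" and nn: "\<not> padic_null p X"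
  shows "padic_Cauchy p (\<lambda>n. inverse (X n))"
  unfolding padic_Cauchy_def
proof (intro allI impI)
  fix e :: real assume e: "e > 0"
  obtain b N where b: "b > 0" "\<And>n. n \<ge> N \<Longrightarrow> padic_abs p (X n) > b"
    using padic_Cauchy_not_null[OF assms] by blast
  have "e * (b * b) > 0" using e b by simp
  then obtain M where M: "\<And>m n. m \<ge> M \<Longrightarrow> n \<ge> M \<Longrightarrow> padic_abs p (X m - X n) < e * (b * b)"
    using X unfolding padic_Cauchy_def by blast
  have "padic_abs p (inverse (X m) - inverse (X n)) < e" if mn: "m \<ge> max M N" "n \<ge> max M N" for m n
  proof -
    have *: "padic_abs p (X m) > b" "padic_abs p (X n) > b" using b(2) mn by auto
    then have nz: "X m \<noteq> 0" "X n \<noteq> 0" using b(1) by auto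
    have "b * b < padic_abs p (X m) * padic_abs p (X n)"
      using * b(1) by (intro mult_strict_mono) auto
    then have "e * (b * b) < e * (padic_abs p (X m) * padic_abs p (X n))"
      using e by (intro mult_strict_left_mono)
    moreover have "padic_abs p (X m - X n) < e * (b * b)" using M mn by simp
    ultimately have "padic_abs p (X m - X n) < e * (padic_abs p (X m) * padic_abs p (X n))"
      by simp
    then show ?thesis
      using * b(1) by (simp add: padic_abs_inverse_diff[OF p nz] pos_divide_less_eq)
  qed
  then show "\<exists>N. \<forall>m\<ge>N. \<forall>n\<ge>N. padic_abs p (inverse (X m) - inverse (X n)) < e" by blast
qed

lemma padic_null_inverse_diff:
  assumes p: "prime p" and X: "padic_Cauchy p X" and nnX: "\<not> padic_null p X"
    and Y: "padic_Cauchy p Y" and nnY: "\<not> padic_null p Y" 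
    and XY: "padic_null p (\<lambda>n. X n - Y n)"
  shows "padic_null p (\<lambda>n. inverse (X n) - inverse (Y n))"
proof -
  obtain b N where b: "b > 0" "\<And>n. n \<ge> N \<Longrightarrow> padic_abs p (X n) > b"
    using padic_Cauchy_not_null[OF p X nnX] by blast
  obtain c M where c: "c > 0" "\<And>n. n \<ge> M \<Longrightarrow> padic_abs p (Y n) > c"
    using padic_Cauchy_not_null[OF p Y nnY] by blast
  have ev: "eventually (\<lambda>n. inverse (X n) * inverse (Y n) * (Y n - X n) = inverse (X n) - inverse (Y n)) sequentially"
    unfolding eventually_sequentially
  proof (intro exI[of _ "max M N"] allI impI)
    fix n assume "n \<ge> max M N"
    then have "padic_abs p (X n) > b" "padic_abs p (Y n) > c" using b(2) c(2) by auto
    then have "X n \<noteq> 0" "Y n \<noteq> 0" using b(1) c(1) by auto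
    then show "inverse (X n) * inverse (Y n) * (Y n - X n) = inverse (X n) - inverse (Y n)"
      by (simp add: field_simps)
  qed
  have "padic_null p (\<lambda>n. Y n - X n)"
    using padic_null_minus[OF XY] by simp
  from padic_null_mult_left[OF p
      padic_Cauchy_mult[OF p padic_Cauchy_inverse[OF p X nnX] padic_Cauchy_inverse[OF p Y nnY]] this]
  show ?thesis unfolding padic_null_def
    by (rule Lim_transform_eventually) (use ev in \<open>auto elim!: eventually_mono\<close>)
qed

definition padic_rel :: "nat \<Rightarrow> (nat \<Rightarrow> rat) \<Rightarrow> (nat \<Rightarrow> rat) \<Rightarrow> bool" where
  "padic_rel p X Y \<longleftrightarrow> padic_Cauchy p X \<and> padic_Cauchy p Y \<and> padic_null p (\<lambda>n. X n - Y n)"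

lemma padic_rel_refl: "padic_Cauchy p X \<Longrightarrow> padic_rel p X X"
  by (simp add: padic_rel_def)

lemma part_equivp_padic_rel:
  assumes p: "prime p" shows "part_equivp (padic_rel p)"
proof (rule part_equivpI)
  show "\<exists>X. padic_rel p X X" by (rule exI[of _ "\<lambda>_. 0"]) (simp add: padic_rel_def)
  show "symp (padic_rel p)"
    unfolding symp_def padic_rel_def padic_null_def by (metis (no_types, lifting) ext padic_abs_minus_commute)
  show "transp (padic_rel p)"
    unfolding transp_def padic_rel_def
  proof (intro allI impI, elim conjE, intro conjI)
    fix X Y Z assume "padic_null p (\<lambda>n. X n - Y n)" "padic_null p (\<lambda>n. Y n - Z n)"
    from padic_null_add[OF p this] show "padic_null p (\<lambda>n. X n - Z n)" by simp
  qed
qed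

lemma padic_rel_inverse:
  assumes p: "prime p" and r: "padic_rel p X Y"
  shows "padic_rel p (if padic_null p X then (\<lambda>n. 0) else (\<lambda>n. inverse (X n)))
    (if padic_null p Y then (\<lambda>n. 0) else (\<lambda>n. inverse (Y n)))"
proof -
  have XY: "padic_null p (\<lambda>n. X n - Y n)" using r by (simp add: padic_rel_def)
  have "padic_null p X \<longleftrightarrow> padic_null p Y"
    using padic_null_add[OF p XY, of Y] padic_null_diff[OF p _ XY, of X] by auto
  with r show ?thesis
    by (auto simp: padic_rel_def padic_null_inverse_diff[OF p] padic_Cauchy_inverse[OF p])
qed

typedef (overloaded) ('p::prime_card) padic =
  "{C. \<exists>X. padic_rel CARD('p) X X \<and> C = Collect (padic_rel CARD('p) X)}"
  using padic_rel_refl[OF padic_Cauchy_const] by blast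

definition padic_of_seq :: "(nat \<Rightarrow> rat) \<Rightarrow> 'p::prime_card padic" where
  "padic_of_seq X = Abs_padic (Collect (padic_rel CARD('p) X))"

definition seq_of_padic :: "'p::prime_card padic \<Rightarrow> nat \<Rightarrow> rat" where
  "seq_of_padic x = (SOME X. X \<in> Rep_padic x)"

definition cr_padic :: "(nat \<Rightarrow> rat) \<Rightarrow> 'p::prime_card padic \<Rightarrow> bool" where
  "cr_padic = (\<lambda>X x. padic_rel CARD('p) X X \<and> padic_of_seq X = x)"

lemma Quotient_padic:
  "Quotient (padic_rel CARD('p)) padic_of_seq seq_of_padic (cr_padic :: _ \<Rightarrow> 'p::prime_card padic \<Rightarrow> bool)"
proof -
  interpret quot_type "padic_rel CARD('p)" "Abs_padic :: _ \<Rightarrow> 'p padic" Rep_padic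
    using Rep_padic
    by unfold_locales (auto simp: part_equivp_padic_rel[OF prime_card] Rep_padic_inverse
        Abs_padic_inverse Rep_padic_inject)
  have "abs = padic_of_seq" "rep = seq_of_padic"
    by (auto simp: fun_eq_iff abs_def padic_of_seq_def rep_def seq_of_padic_def)
  then have Q: "Quotient3 (padic_rel CARD('p)) (padic_of_seq :: _ \<Rightarrow> 'p padic) seq_of_padic"
    using Quotient by simp
  show ?thesis
    by (rule Quotient3_to_Quotient[OF Q]) (auto simp: cr_padic_def)
qed

setup_lifting Quotient_padic

lemma padic_rel_mult:
  assumes p: "prime p" and "padic_rel p X Y" "padic_rel p Z W"
  shows "padic_rel p (\<lambda>n. X n * Z n) (\<lambda>n. Y n * W n)"
proof -
  have "padic_null p (\<lambda>n. X n * (Z n - W n) + W n * (X n - Y n))"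
    using assms unfolding padic_rel_def
    by (intro padic_null_add padic_null_mult_left) auto
  moreover have "(\<lambda>n. X n * (Z n - W n) + W n * (X n - Y n)) = (\<lambda>n. X n * Z n - Y n * W n)"
    by (auto simp: algebra_simps)
  ultimately show ?thesis
    using assms by (simp add: padic_rel_def padic_Cauchy_mult)
qed

lemma padic_rel_add:
  assumes p: "prime p" and "padic_rel p X Y" "padic_rel p Z W"
  shows "padic_rel p (\<lambda>n. X n + Z n) (\<lambda>n. Y n + W n)"
  using assms padic_null_add[OF p, of "\<lambda>n. X n - Y n" "\<lambda>n. Z n - W n"]
  by (simp add: padic_rel_def padic_Cauchy_add add_diff_add)

lemma padic_rel_minus:
  assumes "padic_rel p X Y" shows "padic_rel p (\<lambda>n. - X n) (\<lambda>n. - Y n)"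
  using assms padic_null_minus[of p "\<lambda>n. X n - Y n"]
  unfolding padic_rel_def minus_diff_minus by (simp add: padic_Cauchy_minus)

lemma padic_rel_eq_self_iff: "padic_rel p X X \<longleftrightarrow> padic_Cauchy p X"
  by (simp add: padic_rel_def)

lemma padic_rel_lim_abs:
  assumes p: "prime p" and r: "padic_rel p X Y"
  shows "lim (\<lambda>n. padic_abs p (X n)) = lim (\<lambda>n. padic_abs p (Y n))"
proof -
  have "padic_null p (\<lambda>n. X n - Y n)" using r by (simp add: padic_rel_def)
  then have "(\<lambda>n. padic_abs p (X n) - padic_abs p (Y n)) \<longlonglongrightarrow> 0"
    unfolding padic_null_def
    by (rule Lim_null_comparison[rotated]) (simp add: padic_abs_diff_abs[OF p])
  moreover have "(\<lambda>n. padic_abs p (Y n)) \<longlonglongrightarrow> lim (\<lambda>n. padic_abs p (Y n))"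
    using r by (auto simp: padic_rel_def convergent_LIMSEQ_iff[symmetric] padic_Cauchy_convergent[OF p])
  ultimately have "(\<lambda>n. padic_abs p (X n) - padic_abs p (Y n) + padic_abs p (Y n)) \<longlonglongrightarrow> 
      0 + lim (\<lambda>n. padic_abs p (Y n))"
    by (rule tendsto_add)
  then show ?thesis by (simp add: limI)
qed

instantiation padic :: (prime_card) field
begin

lift_definition zero_padic :: "'a padic" is "\<lambda>n. 0"
  by (simp add: padic_rel_refl)

lift_definition one_padic :: "'a padic" is "\<lambda>n. 1"
  by (simp add: padic_rel_refl)

lift_definition plus_padic :: "'a padic \<Rightarrow> 'a padic \<Rightarrow> 'a padic" is "\<lambda>X Y n. X n + Y n"
  by (rule padic_rel_add[OF prime_card])

lift_definition uminus_padic :: "'a padic \<Rightarrow> 'a padic" is "\<lambda>X n. - X n"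
  by (rule padic_rel_minus)

lift_definition times_padic :: "'a padic \<Rightarrow> 'a padic \<Rightarrow> 'a padic" is "\<lambda>X Y n. X n * Y n"
  by (rule padic_rel_mult[OF prime_card])

lift_definition inverse_padic :: "'a padic \<Rightarrow> 'a padic"
  is "\<lambda>X. if padic_null CARD('a) X then (\<lambda>n. 0) else (\<lambda>n. inverse (X n))"
  by (rule padic_rel_inverse[OF prime_card])

definition "x - y = x + - (y :: 'a padic)"
definition "x div y = x * inverse (y :: 'a padic)"

instance
proof
  fix x y z :: "'a padic"
  show "x + y + z = x + (y + z)"
    by transfer (auto simp: padic_rel_eq_self_iff add.assoc prime_card intro!: padic_rel_refl padic_Cauchy_add)
  show "x + y = y + x"
    by transfer (auto simp: padic_rel_eq_self_iff add.commute prime_card intro!: padic_rel_refl padic_Cauchy_add)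
  show "0 + x = x"
    by transfer (auto simp: padic_rel_eq_self_iff)
  show "- x + x = 0"
    by transfer (auto simp: padic_rel_eq_self_iff)
  show "x - y = x + - y" by (rule minus_padic_def)
  show "x * y * z = x * (y * z)"
    by transfer (auto simp: padic_rel_eq_self_iff mult.assoc prime_card intro!: padic_rel_refl padic_Cauchy_mult)
  show "x * y = y * x"
    by transfer (auto simp: padic_rel_eq_self_iff mult.commute prime_card intro!: padic_rel_refl padic_Cauchy_mult)
  show "1 * x = x"
    by transfer (auto simp: padic_rel_eq_self_iff)
  show "(x + y) * z = x * z + y * z"
    by transfer (auto simp: padic_rel_eq_self_iff distrib_right prime_card
        intro!: padic_rel_refl padic_Cauchy_mult padic_Cauchy_add)
  show "(0 :: 'a padic) \<noteq> 1"
    by transfer (simp add: padic_rel_def padic_null_def tendsto_const_iff)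
  show "inverse (0 :: 'a padic) = 0"
    by transfer (simp add: padic_rel_refl)
  show "x div y = x * inverse y" by (rule divide_padic_def)
  show "x \<noteq> 0 \<Longrightarrow> inverse x * x = 1"
  proof transfer
    fix X assume "padic_rel CARD('a) X X" and nn: "\<not> padic_rel CARD('a) X (\<lambda>n. 0)"
    then have X: "padic_Cauchy CARD('a) X" and nX: "\<not> padic_null CARD('a) X"
      by (auto simp: padic_rel_def)
    obtain b N where b: "b > 0" "\<And>n. n \<ge> N \<Longrightarrow> padic_abs CARD('a) (X n) > b"
      using padic_Cauchy_not_null[OF prime_card X nX] by blast
    have "inverse (X n) * X n - 1 = 0" if "n \<ge> N" for n
      using b(2)[OF that] b(1) by (cases "X n = 0") auto
    then have "padic_null CARD('a) (\<lambda>n. inverse (X n) * X n - 1)"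
      unfolding padic_null_def 
      by (intro tendsto_eventually) (auto simp: eventually_sequentially intro!: exI[of _ N])
    then show "padic_rel CARD('a)
        (\<lambda>n. (if padic_null CARD('a) X then (\<lambda>n. 0) else (\<lambda>n. inverse (X n))) n * X n) (\<lambda>n. 1)"
      using nX X by (simp add: padic_rel_def padic_Cauchy_mult padic_Cauchy_inverse prime_card)
  qed
qed

end

text \<open>
  A separate constant, since \<open>norm\<close> is constrained to real normed vector spaces, which
  \<open>\<rat>\<^sub>p\<close> is not.
\<close>

lift_definition padic_norm :: "'p::prime_card padic \<Rightarrow> real" is "\<lambda>X. lim (\<lambda>n. padic_abs CARD('p) (X n))"
  by (rule padic_rel_lim_abs[OF prime_card])

lemma padic_seq_cases:
  fixes x :: "'p::prime_card padic"
  obtains X where "padic_Cauchy CARD('p) X" "x = padic_of_seq X"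
  using Quotient_rep_reflp[OF Quotient_padic, of x] Quotient_abs_rep[OF Quotient_padic, of x]
  by (metis padic_rel_eq_self_iff)

lemma tendsto_padic_norm_seq:
  assumes "padic_Cauchy CARD('p) X"
  shows "(\<lambda>n. padic_abs CARD('p) (X n)) \<longlonglongrightarrow> padic_norm (padic_of_seq X :: 'p::prime_card padic)"
  using padic_Cauchy_convergent[OF prime_card assms] assms
  by (simp add: padic_norm.abs_eq padic_rel_refl convergent_LIMSEQ_iff)

lemma padic_norm_nonneg [simp]: "padic_norm (x :: 'p::prime_card padic) \<ge> 0"
proof (cases x rule: padic_seq_cases)
  case (1 X)
  then show ?thesis using tendsto_lowerbound[OF tendsto_padic_norm_seq[OF 1(1)]] by simp
qed

lemma padic_norm_eq_0_iff [simp]: "padic_norm (x :: 'p::prime_card padic) = 0 \<longleftrightarrow> x = 0"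
proof (cases x rule: padic_seq_cases)
  case (1 X)
  have "x = 0 \<longleftrightarrow> padic_null CARD('p) X"
    using Quotient_rel[OF Quotient_padic, of X "\<lambda>n. 0"] 1 
    by (auto simp: zero_padic_def padic_rel_def)
  then show ?thesis
    using tendsto_padic_norm_seq[OF 1(1)] unfolding padic_null_def 1(2)
    by (metis LIMSEQ_unique)
qed

lemma padic_norm_0 [simp]: "padic_norm (0 :: 'p::prime_card padic) = 0"
  by simp

lemma padic_norm_mult: "padic_norm (x * y) = padic_norm x * padic_norm (y :: 'p::prime_card padic)"
proof (cases x rule: padic_seq_cases; cases y rule: padic_seq_cases)
  fix X Y assume *: "padic_Cauchy CARD('p) X" "x = padic_of_seq X"
    "padic_Cauchy CARD('p) Y" "y = padic_of_seq Y"
  have "x * y = padic_of_seq (\<lambda>n. X n * Y n)"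
    unfolding * using * by (intro times_padic.abs_eq padic_rel_refl)
  with tendsto_padic_norm_seq[OF padic_Cauchy_mult[OF prime_card *(1,3)]]
  have "(\<lambda>n. padic_abs CARD('p) (X n) * padic_abs CARD('p) (Y n)) \<longlonglongrightarrow> padic_norm (x * y)"
    by (simp add: padic_abs_mult prime_card)
  moreover have "(\<lambda>n. padic_abs CARD('p) (X n) * padic_abs CARD('p) (Y n)) \<longlonglongrightarrow> padic_norm x * padic_norm y"
    unfolding * by (intro tendsto_mult tendsto_padic_norm_seq *)
  ultimately show ?thesis by (rule LIMSEQ_unique)
qed

lemma padic_norm_minus [simp]: "padic_norm (- x) = padic_norm (x :: 'p::prime_card padic)"
proof (cases x rule: padic_seq_cases)
  case (1 X)
  then show ?thesis
    by (simp add: uminus_padic.abs_eq padic_norm.abs_eq padic_rel_refl padic_Cauchy_minus)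
qed

lemma padic_norm_add_le_max: "padic_norm (x + y) \<le> max (padic_norm x) (padic_norm (y :: 'p::prime_card padic))"
proof (cases x rule: padic_seq_cases; cases y rule: padic_seq_cases)
  fix X Y assume *: "padic_Cauchy CARD('p) X" "x = padic_of_seq X"
    "padic_Cauchy CARD('p) Y" "y = padic_of_seq Y"
  have "x + y = padic_of_seq (\<lambda>n. X n + Y n)"
    unfolding * using * by (intro plus_padic.abs_eq padic_rel_refl)
  with tendsto_padic_norm_seq[OF padic_Cauchy_add[OF prime_card *(1,3)]]
  have "(\<lambda>n. padic_abs CARD('p) (X n + Y n)) \<longlonglongrightarrow> padic_norm (x + y)" by simp
  moreover have "(\<lambda>n. max (padic_abs CARD('p) (X n)) (padic_abs CARD('p) (Y n)))
      \<longlonglongrightarrow> max (padic_norm x) (padic_norm y)"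
    unfolding * by (intro tendsto_max tendsto_padic_norm_seq *)
  ultimately show ?thesis
    by (rule LIMSEQ_le) (auto simp: padic_abs_add_le_max prime_card)
qed

lemma padic_norm_triangle: "padic_norm (x + y) \<le> padic_norm x + padic_norm (y :: 'p::prime_card padic)"
  using padic_norm_add_le_max[of x y] padic_norm_nonneg[of x] padic_norm_nonneg[of y] by linarith

lemma padic_norm_minus_commute: "padic_norm (x - y) = padic_norm (y - x :: 'p::prime_card padic)"
  by (metis minus_diff_eq padic_norm_minus)

instantiation padic :: (prime_card) metric_space
begin

definition dist_padic :: "'a padic \<Rightarrow> 'a padic \<Rightarrow> real" where
  "dist_padic x y = padic_norm (x - y)"

definition uniformity_padic :: "('a padic \<times> 'a padic) filter" where
  "uniformity_padic = (INF e\<in>{0 <..}. principal {(x, y). dist x y < e})"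

definition open_padic :: "'a padic set \<Rightarrow> bool" where
  "open_padic U \<longleftrightarrow> (\<forall>x\<in>U. eventually (\<lambda>(x', y). x' = x \<longrightarrow> y \<in> U) uniformity)"

instance
proof
  fix x y z :: "'a padic" and U :: "'a padic set"
  show "uniformity = (INF e\<in>{0 <..}. principal {(x, y :: 'a padic). dist x y < e})"
    by (rule uniformity_padic_def)
  show "open U \<longleftrightarrow> (\<forall>x\<in>U. \<forall>\<^sub>F (x', y) in uniformity. x' = x \<longrightarrow> y \<in> U)"
    by (rule open_padic_def)
  show "dist x y = 0 \<longleftrightarrow> x = y" by (simp add: dist_padic_def)
  show "dist x y \<le> dist x z + dist y z"
    using padic_norm_triangle[of "x - z" "z - y"] padic_norm_minus_commute[of z y]
    by (simp add: dist_padic_def)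
qed

end

lemma padic_norm_1 [simp]: "padic_norm (1 :: 'p::prime_card padic) = 1"
  by (simp add: one_padic_def padic_norm.abs_eq padic_rel_refl)

lemma padic_of_nat_seq: "of_nat k = (padic_of_seq (\<lambda>n. of_nat k) :: 'p::prime_card padic)"
proof (induction k)
  case (Suc k)
  have "of_nat (Suc k) = (padic_of_seq (\<lambda>n. 1) + padic_of_seq (\<lambda>n. of_nat k) :: 'p padic)"
    by (simp add: Suc one_padic_def)
  also have "\<dots> = padic_of_seq (\<lambda>n. 1 + of_nat k)"
    by (intro plus_padic.abs_eq padic_rel_refl padic_Cauchy_const)
  finally show ?case by simp
qed (simp add: zero_padic_def)

lemma padic_norm_seq_const: "padic_norm (padic_of_seq (\<lambda>n. q) :: 'p padic) = padic_abs CARD('p::prime_card) q"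
  by (simp add: padic_norm.abs_eq padic_rel_refl)

instance padic :: (prime_card) field_char_0
proof
  have "of_nat k \<noteq> (0 :: 'a padic)" if "k > 0" for k
  proof -
    have "padic_norm (of_nat k :: 'a padic) = padic_abs CARD('a) (of_nat k)"
      by (simp add: padic_of_nat_seq padic_norm_seq_const)
    also have "\<dots> \<noteq> 0" using that by (simp add: prime_card)
    finally show ?thesis by auto
  qed
  then have *: "of_nat m \<noteq> (of_nat n :: 'a padic)" if "m > n" for m n
    using that by (metis diff_gt_0_iff_gt less_imp_le of_nat_diff right_minus_eq zero_less_diff)
  show "inj (of_nat :: nat \<Rightarrow> 'a padic)"
  proof (rule injI)
    fix m n assume "of_nat m = (of_nat n :: 'a padic)"
    then show "m = n" using *[of n m] *[of m n] by (cases m n rule: linorder_cases) auto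
  qed
qed

lemma padic_of_rat_seq: "of_rat q = (padic_of_seq (\<lambda>n. q) :: 'p::prime_card padic)"
proof -
  have nat: "of_rat (of_nat k) = (padic_of_seq (\<lambda>n. of_nat k) :: 'p::prime_card padic)" for k
    by (simp add: padic_of_nat_seq)
  have int: "of_rat (of_int k) = (padic_of_seq (\<lambda>n. of_int k) :: 'p::prime_card padic)" for k
  proof (cases k)
    case (neg n)
    have "padic_of_seq (\<lambda>n. - q) = - (padic_of_seq (\<lambda>n. q) :: 'p padic)" for q
      by (subst uminus_padic.abs_eq) (auto intro: padic_rel_refl)
    from this[of "of_nat (Suc n)"] nat[of "Suc n"]
    have "of_rat (- of_nat (Suc n)) = (padic_of_seq (\<lambda>m. - of_nat (Suc n)) :: 'p padic)"
      by (simp only: of_rat_minus)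
    moreover have "of_int k = (- of_nat (Suc n) :: rat)" using neg by simp
    ultimately show ?thesis by simp
  qed (simp add: padic_of_nat_seq)
  obtain a b where q: "q = of_int a / of_int b" "b \<noteq> 0" by (rule rat_fraction_cases)
  have "padic_of_seq (\<lambda>n. q) * padic_of_seq (\<lambda>n. of_int b) = (padic_of_seq (\<lambda>n. q * of_int b) :: 'p padic)"
    by (intro times_padic.abs_eq padic_rel_refl padic_Cauchy_const)
  also have "q * of_int b = of_int a" using q by simp
  finally have "padic_of_seq (\<lambda>n. q) * of_int b = (of_int a :: 'p padic)"
    by (simp add: int[symmetric])
  then have "padic_of_seq (\<lambda>n. q) = (of_int a / of_int b :: 'p padic)"
    using q(2) by (simp add: nonzero_eq_divide_eq)
  then show ?thesis by (simp add: q(1) of_rat_divide)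
qed

lemma padic_norm_of_rat: "padic_norm (of_rat q :: 'p padic) = padic_abs CARD('p::prime_card) q"
  by (simp add: padic_of_rat_seq padic_norm_seq_const)

lemma padic_tendsto_of_rat_seq:
  assumes X: "padic_Cauchy CARD('p::prime_card) X"
  shows "(\<lambda>n. of_rat (X n)) \<longlonglongrightarrow> (padic_of_seq X :: 'p padic)"
proof (rule metric_LIMSEQ_I)
  fix e :: real assume "e > 0"
  then have "e / 2 > 0" by simp
  then obtain N where N: "\<And>m n. m \<ge> N \<Longrightarrow> n \<ge> N \<Longrightarrow> padic_abs CARD('p) (X m - X n) < e / 2"
    using X unfolding padic_Cauchy_def by blast
  have "dist (of_rat (X n)) (padic_of_seq X :: 'p padic) < e" if "n \<ge> N" for n
  proof -
    have C: "padic_Cauchy CARD('p) (\<lambda>m. X n + - X m)"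
      by (intro padic_Cauchy_add padic_Cauchy_minus prime_card X padic_Cauchy_const)
    have "of_rat (X n) - padic_of_seq X = (padic_of_seq (\<lambda>m. X n) + padic_of_seq (\<lambda>m. - X m) :: 'p padic)"
      using X by (simp add: padic_of_rat_seq uminus_padic.abs_eq padic_rel_refl)
    also have "\<dots> = padic_of_seq (\<lambda>m. X n + - X m)"
      by (intro plus_padic.abs_eq padic_rel_refl padic_Cauchy_const padic_Cauchy_minus X)
    finally have "dist (of_rat (X n)) (padic_of_seq X :: 'p padic) = padic_norm (padic_of_seq (\<lambda>m. X n + - X m) :: 'p padic)"
      by (simp add: dist_padic_def)
    also have "\<dots> \<le> e / 2"
      by (rule tendsto_upperbound[OF tendsto_padic_norm_seq[OF C]])
         (use N[of n] that in \<open>auto simp: eventually_sequentially intro!: exI[of _ N] less_imp_le\<close>)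
    finally show ?thesis using \<open>e > 0\<close> by simp
  qed
  then show "\<exists>N. \<forall>n\<ge>N. dist (of_rat (X n)) (padic_of_seq X :: 'p padic) < e" by blast
qed

lemma padic_rat_dense:
  assumes "e > 0" obtains q where "dist x (of_rat q :: 'p::prime_card padic) < e"
proof (cases x rule: padic_seq_cases)
  case (1 X)
  from metric_LIMSEQ_D[OF padic_tendsto_of_rat_seq[OF 1(1)] assms] that
  show ?thesis by (auto simp: 1(2) dist_commute)
qed

instance padic :: (prime_card) complete_space
proof
  fix x :: "nat \<Rightarrow> 'a padic" assume x: "Cauchy x"
  have "\<exists>q. dist (x n) (of_rat q) < inverse (real (Suc n))" for n
    using padic_rat_dense[of "inverse (real (Suc n))" "x n"] by auto
  then obtain q where q: "\<And>n. dist (x n) (of_rat (q n)) < inverse (real (Suc n))" by metis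
  have lim0: "(\<lambda>n. dist (x n) (of_rat (q n))) \<longlonglongrightarrow> 0"
    by (rule tendsto_sandwich[OF _ _ tendsto_const LIMSEQ_inverse_real_of_nat])
       (auto intro!: always_eventually less_imp_le[OF q] simp del: of_nat_Suc)
  have d: "padic_abs CARD('a) (a - b) = dist (of_rat a :: 'a padic) (of_rat b)" for a b
    by (simp add: dist_padic_def padic_norm_of_rat flip: of_rat_diff)
  have "padic_Cauchy CARD('a) q"
    unfolding padic_Cauchy_def d
  proof (intro allI impI)
    fix e :: real assume "e > 0"
    then have "e / 3 > 0" by simp
    obtain N where N: "\<And>m n. m \<ge> N \<Longrightarrow> n \<ge> N \<Longrightarrow> dist (x m) (x n) < e / 3"
      using metric_CauchyD[OF x \<open>e / 3 > 0\<close>] by blast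
    obtain M where M: "\<And>n. n \<ge> M \<Longrightarrow> dist (x n) (of_rat (q n)) < e / 3"
      using metric_LIMSEQ_D[OF lim0 \<open>e / 3 > 0\<close>] by auto
    have "dist (of_rat (q m)) (of_rat (q n) :: 'a padic) < e" if "m \<ge> max M N" "n \<ge> max M N" for m n
      using N[of m n] M[of m] M[of n] that
        dist_triangle[of "of_rat (q m)" "of_rat (q n)" "x m"] dist_triangle[of "x m" "of_rat (q n)" "x n"]
      by (simp add: dist_commute)
    then show "\<exists>N. \<forall>m\<ge>N. \<forall>n\<ge>N. dist (of_rat (q m)) (of_rat (q n) :: 'a padic) < e" by blast
  qed
  from padic_tendsto_of_rat_seq[OF this]
  have "(\<lambda>n. dist (of_rat (q n)) (padic_of_seq q :: 'a padic)) \<longlonglongrightarrow> 0"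
    by (rule tendsto_dist_iff[THEN iffD1])
  from tendsto_add[OF lim0 this]
  have L: "(\<lambda>n. dist (x n) (of_rat (q n)) + dist (of_rat (q n)) (padic_of_seq q :: 'a padic)) \<longlonglongrightarrow> 0" by simp
  have "(\<lambda>n. dist (x n) (padic_of_seq q)) \<longlonglongrightarrow> 0"
    by (rule Lim_null_comparison[OF always_eventually L]) (simp add: dist_triangle)
  then have "x \<longlonglongrightarrow> padic_of_seq q"
    by (rule tendsto_dist_iff[THEN iffD2])
  then show "convergent x" by (auto simp: convergent_def)
qed

definition padic_ball :: "'p::prime_card padic \<Rightarrow> int \<Rightarrow> 'p padic set" where
  "padic_ball a \<gamma> = {x. padic_norm (x - a) \<le> real CARD('p) powi \<gamma>}"

definition is_padic_haar :: "'p::prime_card padic measure \<Rightarrow> bool" where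
  "is_padic_haar M \<longleftrightarrow> sets M = sets borel \<and> (\<forall>a. distr M borel (\<lambda>x. a + x) = M)
     \<and> emeasure M {x. padic_norm x \<le> 1} = 1"

lemma padic_p_gt_1: "real CARD('p::prime_card) > 1"
  using prime_gt_1_nat[OF prime_card[where 'a = 'p]] by simp

lemma padic_norm_diff_le:
  assumes "padic_norm (x - y) \<le> r" "padic_norm (y - z) \<le> r"
  shows "padic_norm (x - z :: 'p::prime_card padic) \<le> r"
  using padic_norm_add_le_max[of "x - y" "y - z"] assms by simp

lemma padic_norm_of_int: "padic_norm (of_int m :: 'p padic) = padic_abs CARD('p::prime_card) (of_int m)"
  using padic_norm_of_rat[of "of_int m", where 'p = 'p] by simp

lemma padic_norm_of_int_le_1: "padic_norm (of_int m :: 'p::prime_card padic) \<le> 1"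
  by (simp add: padic_norm_of_int padic_abs_of_int_le_1 prime_card)

lemma padic_norm_p: "padic_norm (of_nat CARD('p) :: 'p::prime_card padic) = inverse (real CARD('p))"
proof -
  have "padic_abs CARD('p) (of_int (int CARD('p)) / of_int 1) = inverse (real CARD('p))"
    using prime_card[where 'a = 'p]
    by (subst padic_abs_fraction) (auto simp: power_int_minus)
  then show ?thesis using padic_norm_of_int[of "int CARD('p)", where 'p = 'p] by simp
qed

lemma padic_norm_inverse: "padic_norm (inverse x) = inverse (padic_norm (x :: 'p::prime_card padic))"
proof (cases "x = 0")
  case False
  then have "padic_norm x * padic_norm (inverse x) = 1"
    by (simp flip: padic_norm_mult)
  then show ?thesis by (metis inverse_unique)
qed simp

lemma padic_norm_divide: "padic_norm (x / y) = padic_norm x / padic_norm (y :: 'p::prime_card padic)"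
  by (simp add: divide_inverse padic_norm_mult padic_norm_inverse)

lemma padic_norm_power: "padic_norm (x ^ n) = padic_norm (x :: 'p::prime_card padic) ^ n"
  by (induction n) (auto simp: padic_norm_mult)

lemma padic_norm_power_int: "padic_norm (x powi n) = padic_norm (x :: 'p::prime_card padic) powi n"
  by (simp add: power_int_def padic_norm_power padic_norm_inverse)

lemma padic_norm_p_powi:
  "padic_norm (of_nat CARD('p) powi n :: 'p::prime_card padic) = real CARD('p) powi (- n)"
  by (simp add: padic_norm_power_int padic_norm_p power_int_minus power_int_inverse)

lemma padic_norm_of_int_less_1_iff:
  "padic_norm (of_int m :: 'p::prime_card padic) < 1 \<longleftrightarrow> int CARD('p) dvd m"
  "int CARD('p) dvd m \<Longrightarrow> padic_norm (of_int m :: 'p::prime_card padic) \<le> inverse (real CARD('p))"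
proof -
  show *: "padic_norm (of_int m :: 'p padic) \<le> inverse (real CARD('p))" if dvd: "int CARD('p) dvd m"
  proof -
    obtain c where m: "m = int CARD('p) * c" using dvd by blast
    have "padic_norm (of_int m :: 'p padic) = inverse (real CARD('p)) * padic_norm (of_int c :: 'p padic)"
      by (simp add: m padic_norm_mult padic_norm_p)
    also have "\<dots> \<le> inverse (real CARD('p)) * 1"
      by (intro mult_left_mono padic_norm_of_int_le_1) auto
    finally show ?thesis by simp
  qed
  have "int CARD('p) dvd m" if "padic_norm (of_int m :: 'p padic) < 1"
  proof (rule ccontr)
    assume nd: "\<not> int CARD('p) dvd m"
    then have "m \<noteq> 0" by auto
    then have "padic_abs CARD('p) (of_int m / of_int 1) = 1"
      using not_dvd_imp_multiplicity_0[OF nd] prime_card[where 'a = 'p]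
      by (subst padic_abs_fraction) auto
    then show False using that by (simp add: padic_norm_of_int)
  qed
  moreover have "inverse (real CARD('p)) < 1" using padic_p_gt_1[where 'p = 'p] by (simp add: inverse_less_1_iff)
  ultimately show "padic_norm (of_int m :: 'p padic) < 1 \<longleftrightarrow> int CARD('p) dvd m"
    using * by fastforce
qed

lemma padic_digit_exists:
  fixes x :: "'p::prime_card padic"
  assumes x: "padic_norm x \<le> 1"
  obtains d where "d < CARD('p)" "padic_norm (x - of_nat d) \<le> inverse (real CARD('p))"
proof -
  let ?p = "int CARD('p)"
  have ip: "inverse (real CARD('p)) > 0" "inverse (real CARD('p)) < 1"
    using padic_p_gt_1[where 'p = 'p] by (auto simp: inverse_less_1_iff)
  obtain q where "dist x (of_rat q) < inverse (real CARD('p))"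
    using padic_rat_dense[OF ip(1), of x] by blast
  then have q: "padic_norm (x - of_rat q) \<le> inverse (real CARD('p))"
    by (simp add: dist_padic_def)
  have "padic_norm (of_rat q - 0 :: 'p padic) \<le> 1"
    by (rule padic_norm_diff_le[of _ x]) (use q x ip in \<open>auto simp: padic_norm_minus_commute[of _ x]\<close>)
  then have q1: "padic_abs CARD('p) q \<le> 1" by (simp add: padic_norm_of_rat)
  obtain a b where ab: "quotient_of q = (a, b)" by force
  have b: "b > 0" using quotient_of_denom_pos[OF ab] .
  have q_eq: "q = of_int a / of_int b" using quotient_of_div[OF ab] .
  have ndvd: "\<not> ?p dvd b"
  proof
    assume dvd: "?p dvd b"
    then have "\<not> ?p dvd a"
      using coprime_common_divisor[OF quotient_of_coprime[OF ab], of ?p] padic_p_gt_1[where 'p = 'p] by auto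
    then have na: "\<not> padic_norm (of_int a :: 'p padic) < 1"
      by (simp add: padic_norm_of_int_less_1_iff)
    have "padic_norm (of_int b :: 'p padic) < 1" using dvd by (simp add: padic_norm_of_int_less_1_iff)
    moreover have "padic_norm (of_int b :: 'p padic) > 0" using b by (simp add: less_le)
    moreover have "padic_norm (of_int a :: 'p padic) = padic_norm (of_rat q :: 'p padic) * padic_norm (of_int b :: 'p padic)"
      using b by (simp add: q_eq of_rat_divide flip: padic_norm_mult)
    moreover have "padic_norm (of_rat q :: 'p padic) \<le> 1" using q1 by (simp add: padic_norm_of_rat)
    moreover from this have "padic_norm (of_rat q :: 'p padic) * padic_norm (of_int b :: 'p padic)
        \<le> 1 * padic_norm (of_int b :: 'p padic)"
      by (intro mult_right_mono) auto
    ultimately show False using na by simp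
  qed
  then have "coprime b ?p"
    using prime_card_int[where 'a = 'p] prime_imp_coprime coprime_commute by metis
  then obtain c where c: "[b * c = 1] (mod ?p)" using cong_solve_coprime_int by blast
  define d where "d = nat ((a * c) mod ?p)"
  have dint: "int d = (a * c) mod ?p" unfolding d_def using padic_p_gt_1[where 'p = 'p] by simp
  have "[b * int d = b * (a * c)] (mod ?p)"
    unfolding dint by (intro cong_mult cong_refl) (simp add: cong_def)
  also have "b * (a * c) = a * (b * c)" by simp
  also have "[a * (b * c) = a * 1] (mod ?p)" by (intro cong_mult cong_refl c)
  finally have dvd: "?p dvd a - b * int d" by (simp add: cong_iff_dvd_diff dvd_diff_commute)
  have nb: "padic_norm (of_int b :: 'p padic) = 1"
    using ndvd padic_norm_of_int_less_1_iff(1)[of b, where 'p = 'p] padic_norm_of_int_le_1[of b, where 'p = 'p] by linarith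
  have "of_rat q - of_nat d = (of_int (a - b * int d) / of_int b :: 'p padic)"
    using b by (simp add: q_eq of_rat_divide field_simps)
  then have "padic_norm (of_rat q - of_nat d :: 'p padic) = padic_norm (of_int (a - b * int d) :: 'p padic)"
    by (simp only: padic_norm_divide nb div_by_1)
  also have "\<dots> \<le> inverse (real CARD('p))" by (rule padic_norm_of_int_less_1_iff(2)[OF dvd])
  finally have "padic_norm (x - of_nat d) \<le> inverse (real CARD('p))"
    using q padic_norm_diff_le by blast
  moreover have "d < CARD('p)"
    using dint pos_mod_bound[of ?p "a * c"] padic_p_gt_1[where 'p = 'p] by linarith
  ultimately show ?thesis by (rule that[rotated])
qed

lemma padic_digit_unique:
  assumes "d < CARD('p)" "e < CARD('p)" "padic_norm (of_nat d - of_nat e :: 'p::prime_card padic) < 1"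
  shows "d = e"
proof -
  have "padic_norm (of_int (int d - int e) :: 'p::prime_card padic) < 1" using assms by simp
  then have "int CARD('p) dvd (int d - int e)" by (simp only: padic_norm_of_int_less_1_iff)
  then show ?thesis using assms(1,2) zdvd_imp_le
    by (metis abs_minus_commute dvd_abs_iff linorder_neqE_nat of_nat_less_iff mod_eq_dvd_iff mod_pos_pos_trivial of_nat_0_le_iff of_nat_eq_iff)
qed


lemma padic_p_ne_0 [simp]: "of_nat CARD('p) \<noteq> (0 :: 'p::prime_card padic)" "CARD('p::prime_card) \<noteq> 0"
  using prime_gt_0_nat[OF prime_card[where 'a = 'p]] by auto

lemma padic_ball_eq:
  assumes "b \<in> padic_ball a \<gamma>" shows "padic_ball b \<gamma> = padic_ball (a :: 'p::prime_card padic) \<gamma>"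
  using assms padic_norm_diff_le[of _ b _ a] padic_norm_diff_le[of _ a _ b]
  by (auto simp: padic_ball_def padic_norm_minus_commute[of a b])

lemma padic_ball_mono: "\<gamma> \<le> \<delta> \<Longrightarrow> padic_ball a \<gamma> \<subseteq> padic_ball (a :: 'p::prime_card padic) \<delta>"
proof
  fix x assume g: "\<gamma> \<le> \<delta>" and x: "x \<in> padic_ball a \<gamma>"
  have "real CARD('p) powi \<gamma> \<le> real CARD('p) powi \<delta>"
    using g padic_p_gt_1[where 'p = 'p] by (intro power_int_increasing) auto
  then show "x \<in> padic_ball a \<delta>" using x by (simp add: padic_ball_def)
qed

lemma padic_ball_Int:
  "padic_ball a \<gamma> \<inter> padic_ball b \<delta> \<in> insert {} (range (\<lambda>(a, \<gamma>). padic_ball (a :: 'p::prime_card padic) \<gamma>))"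
proof (cases "padic_ball a \<gamma> \<inter> padic_ball b \<delta> = {}")
  case False
  then obtain c where "c \<in> padic_ball a \<gamma>" "c \<in> padic_ball b \<delta>" by blast
  then have *: "padic_ball a \<gamma> = padic_ball c \<gamma>" "padic_ball b \<delta> = padic_ball c \<delta>"
    using padic_ball_eq by blast+
  have "padic_ball a \<gamma> \<inter> padic_ball b \<delta> = padic_ball c (min \<gamma> \<delta>)"
    unfolding * using padic_ball_mono[of \<gamma> \<delta> c] padic_ball_mono[of \<delta> \<gamma> c] by (auto simp: min_def)
  then show ?thesis by auto
qed auto

lemma padic_powi_small:
  assumes "e > 0" obtains n :: nat where "real CARD('p::prime_card) powi (- int n) < e"
proof -
  have "inverse (real CARD('p)) < 1" using padic_p_gt_1[where 'p = 'p] by (simp add: inverse_less_1_iff)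
  from real_arch_pow_inv[OF assms this] show ?thesis
    using that by (auto simp: power_int_minus power_inverse)
qed

lemma padic_powi_large:
  obtains n :: nat where "x < real CARD('p::prime_card) powi (int n)"
  using real_arch_pow[OF padic_p_gt_1[where 'p = 'p], of x] that by auto

lemma open_padic_ball: "open (padic_ball a \<gamma> :: 'p::prime_card padic set)"
  unfolding open_dist
proof
  fix x assume x: "x \<in> padic_ball a \<gamma>"
  have "y \<in> padic_ball a \<gamma>" if "dist y x < real CARD('p) powi \<gamma>" for y
    using that x padic_norm_diff_le[of y x _ a] by (simp add: padic_ball_def dist_padic_def)
  moreover have "real CARD('p) powi \<gamma> > 0" using padic_p_gt_1[where 'p = 'p] by simp
  ultimately show "\<exists>e>0. \<forall>y. dist y x < e \<longrightarrow> y \<in> padic_ball a \<gamma>" by blast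
qed

lemma padic_sets_borel:
  "sets (borel :: 'p::prime_card padic measure) =
    sigma_sets UNIV (insert {} (range (\<lambda>(a, \<gamma>). padic_ball a \<gamma>)))" (is "_ = sigma_sets UNIV ?E")
proof
  show "sigma_sets UNIV ?E \<subseteq> sets borel"
    by (intro sets.sigma_sets_subset[of _ borel, simplified]) (auto intro!: borel_open open_padic_ball)
  have "U \<in> sigma_sets UNIV ?E" if U: "open U" for U :: "'p padic set"
  proof -
    define I where "I = {r :: rat \<times> int. padic_ball (of_rat (fst r) :: 'p padic) (snd r) \<subseteq> U}"
    have "U = (\<Union>(q, \<gamma>)\<in>I. padic_ball (of_rat q) \<gamma>)"
    proof (intro equalityI subsetI)
      fix x assume "x \<in> U"
      then obtain e where e: "e > 0" "\<And>y. dist y x < e \<Longrightarrow> y \<in> U" using U unfolding open_dist by blast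
      obtain n :: nat where n: "real CARD('p) powi (- int n) < e" using padic_powi_small[OF e(1)] by blast
      have "real CARD('p) powi (- int n) > 0" using padic_p_gt_1[where 'p = 'p] by simp
      then obtain q where q: "dist x (of_rat q) < real CARD('p) powi (- int n)"
        using padic_rat_dense by blast
      then have xq: "x \<in> padic_ball (of_rat q) (- int n)" by (simp add: padic_ball_def dist_padic_def)
      have "padic_ball (of_rat q) (- int n) = padic_ball x (- int n)" using padic_ball_eq[OF xq] by simp
      also have "\<dots> \<subseteq> U" using n e(2) by (auto simp: padic_ball_def dist_padic_def)
      finally have "(q, - int n) \<in> I" by (simp add: I_def)
      then show "x \<in> (\<Union>(q, \<gamma>)\<in>I. padic_ball (of_rat q) \<gamma>)" using xq by blast
    qed (auto simp: I_def)
    also have "\<dots> \<in> sigma_sets UNIV ?E"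
    proof (rule sigma_algebra.countable_UN'[OF sigma_algebra_sigma_sets])
      show "countable I" by (rule countable_subset[of _ UNIV]) auto
      show "(\<lambda>(q, \<gamma>). padic_ball (of_rat q) \<gamma>) ` I \<subseteq> sigma_sets UNIV ?E"
        by (auto intro!: sigma_sets.Basic)
    qed auto
    finally show ?thesis .
  qed
  then have "sigma_sets UNIV {S :: 'p padic set. open S} \<subseteq> sigma_sets UNIV ?E"
    by (intro sigma_sets_mono) auto
  then show "sets borel \<subseteq> sigma_sets UNIV ?E" by (simp add: borel_def)
qed

lemma padic_UN_balls: "(\<Union>n::nat. padic_ball 0 (int n)) = (UNIV :: 'p::prime_card padic set)"
proof -
  have "x \<in> (\<Union>n::nat. padic_ball 0 (int n))" for x :: "'p padic"
  proof -
    obtain n :: nat where "padic_norm x < real CARD('p) powi (int n)"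
      using padic_powi_large[of "padic_norm x", where 'p = 'p] by blast
    then have "x \<in> padic_ball 0 (int n)" by (simp add: padic_ball_def del: power_int_of_nat)
    then show ?thesis by blast
  qed
  then show ?thesis by blast
qed

lemma padic_measure_eqI:
  fixes M N :: "'p::prime_card padic measure"
  assumes "sets M = sets borel" "sets N = sets borel"
    and eq: "\<And>a \<gamma>. emeasure M (padic_ball a \<gamma>) = emeasure N (padic_ball a \<gamma>)"
    and fin: "\<And>n::nat. emeasure M (padic_ball 0 (int n)) \<noteq> \<infinity>"
  shows "M = N"
proof (rule measure_eqI_generator_eq)
  let ?E = "insert {} (range (\<lambda>(a, \<gamma>). padic_ball a \<gamma>)) :: 'p padic set set"
  show "Int_stable ?E"
  proof (rule Int_stableI)
    fix A B assume "A \<in> ?E" "B \<in> ?E"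
    then consider "A = {}" | "B = {}" | a \<gamma> b \<delta> where "A = padic_ball a \<gamma>" "B = padic_ball b \<delta>" by auto
    then show "A \<inter> B \<in> ?E"
    proof cases
      case 3 then show ?thesis by (simp only: padic_ball_Int)
    qed auto
  qed
  show "?E \<subseteq> Pow UNIV" by simp
  show "emeasure M X = emeasure N X" if "X \<in> ?E" for X using that eq by auto
  show "sets M = sigma_sets UNIV ?E" "sets N = sigma_sets UNIV ?E"
    using assms padic_sets_borel by auto
  show "range (\<lambda>n::nat. padic_ball 0 (int n)) \<subseteq> ?E" by auto
  show "(\<Union>n::nat. padic_ball 0 (int n)) = (UNIV :: 'p padic set)" by (rule padic_UN_balls)
  show "emeasure M (padic_ball 0 (int n)) \<noteq> \<infinity>" for n :: nat by (rule fin)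
qed

lemma padic_ball_translate: "(\<lambda>x. a + x) -` padic_ball b \<gamma> = padic_ball (b - a :: 'p::prime_card padic) \<gamma>"
  by (auto simp: padic_ball_def algebra_simps)

lemma padic_translate_measurable: "(\<lambda>x. a + x) \<in> borel \<rightarrow>\<^sub>M (borel :: 'p::prime_card padic measure)"
proof (rule borel_measurable_continuous_onI)
  show "continuous_on UNIV (\<lambda>x. a + x)"
    unfolding continuous_on_iff by (auto simp: dist_padic_def)
qed

lemma padic_ball_split:
  fixes a :: "'p::prime_card padic"
  shows "padic_ball a (\<gamma> + 1) = (\<Union>d<CARD('p). padic_ball (a + of_nat d * of_nat CARD('p) powi (- (\<gamma> + 1))) \<gamma>)"
    and "disjoint_family_on (\<lambda>d. padic_ball (a + of_nat d * of_nat CARD('p) powi (- (\<gamma> + 1))) \<gamma>) {..<CARD('p)}"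
proof -
  let ?t = "of_nat CARD('p) powi (- (\<gamma> + 1)) :: 'p padic"
  have nt: "padic_norm ?t = real CARD('p) powi (\<gamma> + 1)"
    unfolding padic_norm_p_powi by (simp only: minus_minus)
  have t0: "?t \<noteq> 0" by (simp add: power_int_not_zero)
  have pos: "real CARD('p) powi (\<gamma> + 1) > 0" using padic_p_gt_1[where 'p = 'p] by simp
  have step: "real CARD('p) powi \<gamma> = inverse (real CARD('p)) * real CARD('p) powi (\<gamma> + 1)"
    by (simp add: power_int_add)
  have ball: "x \<in> padic_ball (a + of_nat d * ?t) \<gamma> \<longleftrightarrow>
      padic_norm ((x - a) / ?t - of_nat d) \<le> inverse (real CARD('p))" for x d
  proof -
    have "x - (a + of_nat d * ?t) = ((x - a) / ?t - of_nat d) * ?t"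
      using t0 by (simp add: field_simps)
    then show ?thesis
      unfolding padic_ball_def mem_Collect_eq step using pos by (simp only: padic_norm_mult nt mult_le_cancel_right_pos)
  qed
  have Ball: "x \<in> padic_ball a (\<gamma> + 1) \<longleftrightarrow> padic_norm ((x - a) / ?t) \<le> 1" for x
    unfolding padic_ball_def padic_norm_divide nt using pos by simp
  have inv1: "inverse (real CARD('p)) < 1" using padic_p_gt_1[where 'p = 'p] by (simp add: inverse_less_1_iff)
  show "padic_ball a (\<gamma> + 1) = (\<Union>d<CARD('p). padic_ball (a + of_nat d * ?t) \<gamma>)"
  proof (intro equalityI subsetI)
    fix x assume "x \<in> padic_ball a (\<gamma> + 1)"
    then obtain d where "d < CARD('p)" "padic_norm ((x - a) / ?t - of_nat d) \<le> inverse (real CARD('p))"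
      unfolding Ball by (rule padic_digit_exists)
    then show "x \<in> (\<Union>d<CARD('p). padic_ball (a + of_nat d * ?t) \<gamma>)" using ball by blast
  next
    fix x assume "x \<in> (\<Union>d<CARD('p). padic_ball (a + of_nat d * ?t) \<gamma>)"
    then obtain d where "padic_norm ((x - a) / ?t - of_nat d) \<le> inverse (real CARD('p))" using ball by blast
    then have "padic_norm ((x - a) / ?t - of_nat d) \<le> 1" using inv1 by simp
    moreover have "padic_norm (of_nat d - 0 :: 'p padic) \<le> 1"
      using padic_norm_of_int_le_1[of "int d", where 'p = 'p] by simp
    ultimately have "padic_norm ((x - a) / ?t - 0) \<le> 1" by (rule padic_norm_diff_le)
    then show "x \<in> padic_ball a (\<gamma> + 1)" by (simp add: Ball)
  qed
  show "disjoint_family_on (\<lambda>d. padic_ball (a + of_nat d * ?t) \<gamma>) {..<CARD('p)}"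
    unfolding disjoint_family_on_def
  proof (intro ballI impI)
    fix d e assume de: "d \<in> {..<CARD('p)}" "e \<in> {..<CARD('p)}" "d \<noteq> e"
    have False if "x \<in> padic_ball (a + of_nat d * ?t) \<gamma>" "x \<in> padic_ball (a + of_nat e * ?t) \<gamma>" for x
    proof -
      have "padic_norm (of_nat d - of_nat e :: 'p padic) \<le> inverse (real CARD('p))"
        using that unfolding ball
        by (metis padic_norm_diff_le padic_norm_minus_commute)
      then show False using padic_digit_unique[of d e, where 'p = 'p] de inv1 by simp
    qed
    then show "padic_ball (a + of_nat d * ?t) \<gamma> \<inter> padic_ball (a + of_nat e * ?t) \<gamma> = {}" by blast
  qed
qed

lemma padic_haar_translate_ball:
  assumes "is_padic_haar M"
  shows "emeasure M (padic_ball a \<gamma>) = emeasure M (padic_ball (0 :: 'p::prime_card padic) \<gamma>)"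
proof -
  have s: "sets M = sets borel" and d: "distr M borel (\<lambda>x. a + x) = M"
    using assms by (auto simp: is_padic_haar_def)
  have "emeasure M (padic_ball a \<gamma>) = emeasure (distr M borel (\<lambda>x. a + x)) (padic_ball a \<gamma>)"
    by (simp add: d)
  also have "\<dots> = emeasure M ((\<lambda>x. a + x) -` padic_ball a \<gamma> \<inter> space M)"
    by (rule emeasure_distr) (auto simp: s padic_translate_measurable cong: measurable_cong_sets intro!: borel_open open_padic_ball)
  also have "space M = UNIV" using sets_eq_imp_space_eq[OF s] by simp
  finally show ?thesis by (simp add: padic_ball_translate)
qed

lemma padic_haar_ball_Suc:
  assumes M: "is_padic_haar M"
  shows "emeasure M (padic_ball (0 :: 'p::prime_card padic) (\<gamma> + 1)) = of_nat CARD('p) * emeasure M (padic_ball 0 \<gamma>)"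
proof -
  have s: "sets M = sets borel" using M by (auto simp: is_padic_haar_def)
  let ?B = "\<lambda>d. padic_ball (0 + of_nat d * of_nat CARD('p) powi (- (\<gamma> + 1))) \<gamma> :: 'p padic set"
  have "emeasure M (padic_ball 0 (\<gamma> + 1)) = emeasure M (\<Union>d<CARD('p). ?B d)"
    by (simp only: padic_ball_split)
  also have "\<dots> = (\<Sum>d<CARD('p). emeasure M (?B d))"
    by (rule sum_emeasure[symmetric])
       (use padic_ball_split(2)[of 0 \<gamma>] in \<open>auto simp: s intro!: borel_open open_padic_ball\<close>)
  also have "\<dots> = (\<Sum>d<CARD('p). emeasure M (padic_ball (0 :: 'p padic) \<gamma>))"
    by (intro sum.cong refl padic_haar_translate_ball[OF M])
  finally show ?thesis by simp
qed

lemma padic_haar_ball: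
  assumes M: "is_padic_haar (M :: 'p::prime_card padic measure)"
  shows "emeasure M (padic_ball a \<gamma>) = ennreal (real CARD('p) powi \<gamma>)"
proof -
  have pos: "real CARD('p) > 0" using padic_p_gt_1[where 'p = 'p] by simp
  have "emeasure M (padic_ball 0 \<gamma>) = ennreal (real CARD('p) powi \<gamma>)"
  proof (induction \<gamma> rule: int_induct[where k = 0])
    case base
    show ?case using M by (simp add: is_padic_haar_def padic_ball_def)
  next
    case (step1 i)
    then show ?case
      using pos by (simp add: padic_haar_ball_Suc[OF M] power_int_add ennreal_mult mult.commute
          flip: ennreal_of_nat_eq_real_of_nat)
  next
    case (step2 i)
    have "of_nat CARD('p) * emeasure M (padic_ball 0 (i - 1)) = ennreal (real CARD('p) powi i)"
      using padic_haar_ball_Suc[OF M, of "i - 1"] step2 by simp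
    also have "real CARD('p) powi i = real CARD('p) * real CARD('p) powi (i - 1)"
      using pos by (simp add: power_int_diff)
    also have "ennreal \<dots> = of_nat CARD('p) * ennreal (real CARD('p) powi (i - 1))"
      using pos by (simp add: ennreal_mult flip: ennreal_of_nat_eq_real_of_nat)
    finally show ?case
      using pos by (subst (asm) ennreal_mult_cancel_left) auto
  qed
  then show ?thesis using padic_haar_translate_ball[OF M, of a \<gamma>] by simp
qed

lemma padic_haar_unique:
  assumes "is_padic_haar (M :: 'p::prime_card padic measure)" "is_padic_haar N" shows "M = N"
  using assms by (intro padic_measure_eqI) (auto simp: padic_haar_ball is_padic_haar_def)

text \<open>
  Existence of the Haar measure: Lebesgue measure on \<open>[0, \<infinity>)\<close> is pushed forward along the map that
  reads the base \<open>p\<close> digits of a real in reverse, \<open>\<Sum> d\<^sub>n p\<^sup>-\<^sup>n\<^sup>-\<^sup>1 \<mapsto> \<Sum> d\<^sub>n p\<^sup>n\<close>; preimages of balls are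
  half-open intervals. The value \<open>padic_frac p k\<close> below enumerates the elements of \<open>\<int>[1/p] \<inter> [0, 1)\<close>,
  a system of representatives of \<open>\<rat>\<^sub>p / \<int>\<^sub>p\<close>.
\<close>

function padic_frac :: "nat \<Rightarrow> nat \<Rightarrow> rat" where
  "padic_frac p n = (if n = 0 \<or> p \<le> 1 then 0 else (padic_frac p (n div p) + of_nat (n mod p)) / of_nat p)"
  by auto
termination by (relation "Wellfounded.measure snd") auto

declare padic_frac.simps [simp del]

lemma padic_frac_0 [simp]: "padic_frac p 0 = 0"
  by (simp add: padic_frac.simps)

lemma padic_frac_step:
  assumes "d < CARD('p::prime_card)"
  shows "(of_rat (padic_frac CARD('p) (CARD('p) * k + d)) :: 'p padic) =
     (of_rat (padic_frac CARD('p) k) + of_nat d) / of_nat CARD('p)"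
proof -
  have p: "CARD('p) > 1" using prime_gt_1_nat[OF prime_card[where 'a = 'p]] .
  have "padic_frac CARD('p) (CARD('p) * k + d) = (padic_frac CARD('p) k + of_nat d) / of_nat CARD('p)"
  proof (cases "CARD('p) * k + d = 0")
    case True
    then show ?thesis using p by (simp add: padic_frac.simps)
  next
    case False
    then show ?thesis using p assms by (subst padic_frac.simps) simp
  qed
  then show ?thesis by (simp add: of_rat_divide of_rat_add)
qed

lemma padic_frac_exists:
  fixes x :: "'p::prime_card padic"
  shows "\<exists>k. padic_norm (x - of_rat (padic_frac CARD('p) k)) \<le> 1"
proof -
  have "\<exists>k. padic_norm (x - of_rat (padic_frac CARD('p) k)) \<le> 1"
    if "padic_norm x \<le> real CARD('p) powi (int n)" for n and x :: "'p padic"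
    using that
  proof (induction n arbitrary: x)
    case 0
    then show ?case by (intro exI[of _ 0]) (simp add: padic_frac.simps)
  next
    case (Suc n)
    have pp: "real CARD('p) > 0" using padic_p_gt_1[where 'p = 'p] by simp
    have "padic_norm (of_nat CARD('p) * x) = inverse (real CARD('p)) * padic_norm x"
      by (simp only: padic_norm_mult padic_norm_p)
    also have "\<dots> \<le> inverse (real CARD('p)) * real CARD('p) powi (int (Suc n))"
      using Suc.prems pp by (intro mult_left_mono) auto
    also have "\<dots> = real CARD('p) powi (int n)"
      using pp by (simp only: power_int_of_nat power_Suc) simp
    finally obtain k where k: "padic_norm (of_nat CARD('p) * x - of_rat (padic_frac CARD('p) k)) \<le> 1"
      using Suc.IH by blast
    then obtain d where d: "d < CARD('p)" "padic_norm (of_nat CARD('p) * x - of_rat (padic_frac CARD('p) k) - of_nat d) \<le> inverse (real CARD('p))"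
      by (rule padic_digit_exists)
    have "x - of_rat (padic_frac CARD('p) (CARD('p) * k + d)) =
        (of_nat CARD('p) * x - of_rat (padic_frac CARD('p) k) - of_nat d) / of_nat CARD('p)"
      unfolding padic_frac_step[OF d(1)] by (simp add: field_simps)
    then have "padic_norm (x - of_rat (padic_frac CARD('p) (CARD('p) * k + d))) =
        padic_norm (of_nat CARD('p) * x - of_rat (padic_frac CARD('p) k) - of_nat d) * real CARD('p)"
      by (simp only: padic_norm_divide padic_norm_p) (simp add: field_simps)
    also have "\<dots> \<le> inverse (real CARD('p)) * real CARD('p)"
      using d(2) pp by (intro mult_right_mono) auto
    also have "\<dots> = 1" using pp by simp
    finally show ?case by blast
  qed
  moreover obtain n :: nat where "padic_norm x < real CARD('p) powi (int n)"
    using padic_powi_large[of "padic_norm x", where 'p = 'p] by blast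
  ultimately show ?thesis by (metis less_imp_le)
qed

lemma padic_frac_unique:
  assumes "padic_norm (of_rat (padic_frac CARD('p) k) - of_rat (padic_frac CARD('p) l) :: 'p::prime_card padic) \<le> 1"
  shows "k = l"
  using assms
proof (induction "k + l" arbitrary: k l rule: less_induct)
  case less
  have p1: "CARD('p) > 1" using prime_gt_1_nat[OF prime_card[where 'a = 'p]] .
  have pp: "real CARD('p) > 1" by (rule padic_p_gt_1)
  show ?case
  proof (cases "k = 0 \<and> l = 0")
    case False
    define k' d l' e where kl: "k' = k div CARD('p)" "d = k mod CARD('p)" "l' = l div CARD('p)" "e = l mod CARD('p)"
    have de: "d < CARD('p)" "e < CARD('p)" using p1 by (auto simp: kl)
    have k: "k = CARD('p) * k' + d" and l: "l = CARD('p) * l' + e" by (auto simp: kl)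
    let ?k = "of_rat (padic_frac CARD('p) k') :: 'p padic"
    let ?l = "of_rat (padic_frac CARD('p) l') :: 'p padic"
    have "of_rat (padic_frac CARD('p) k) - of_rat (padic_frac CARD('p) l)
        = ((?k - ?l) + (of_nat d - of_nat e)) / of_nat CARD('p)"
      unfolding k l padic_frac_step[OF de(1)] padic_frac_step[OF de(2)] by (simp add: field_simps)
    then have "padic_norm (((?k - ?l) + (of_nat d - of_nat e)) / of_nat CARD('p)) \<le> 1"
      using less.prems by simp
    then have A: "padic_norm ((?k - ?l) + (of_nat d - of_nat e)) \<le> inverse (real CARD('p))"
      unfolding padic_norm_divide padic_norm_p using pp by (simp add: field_simps)
    have inv1: "inverse (real CARD('p)) < 1" using pp by (simp add: inverse_less_1_iff)
    have "padic_norm (of_int (int e - int d) :: 'p padic) \<le> 1" by (rule padic_norm_of_int_le_1)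
    then have "padic_norm (((?k - ?l) + (of_nat d - of_nat e)) + (of_nat e - of_nat d)) \<le> 1"
      using padic_norm_add_le_max[of "(?k - ?l) + (of_nat d - of_nat e)" "of_nat e - of_nat d"] A inv1 by simp
    then have "padic_norm (?k - ?l) \<le> 1" by simp
    moreover have "k' + l' < k + l"
    proof -
      have "k' \<le> k" "l' \<le> l" by (auto simp: kl)
      moreover have "k' < k \<or> l' < l" using False p1 by (auto simp: kl)
      ultimately show ?thesis by linarith
    qed
    ultimately have "k' = l'" by (rule less.hyps[rotated])
    then have "padic_norm (of_nat d - of_nat e :: 'p padic) < 1" using A inv1 by simp
    then have "d = e" by (rule padic_digit_unique[OF de])
    then show ?thesis using k l \<open>k' = l'\<close> by simp
  qed simp
qed


definition padic_approx :: "int \<Rightarrow> real \<Rightarrow> 'p::prime_card padic" where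
  "padic_approx N t =
     of_rat (padic_frac CARD('p) (nat \<lfloor>t * real CARD('p) powi N\<rfloor>)) * of_nat CARD('p) powi N"

lemma padic_approx_step:
  assumes t: "t \<ge> 0"
  shows "padic_norm (padic_approx (N + 1) t - padic_approx N t :: 'p::prime_card padic) \<le> real CARD('p) powi (- N)"
proof -
  have pp: "real CARD('p) > 1" by (rule padic_p_gt_1)
  define u where "u = t * real CARD('p) powi (N + 1)"
  define m where "m = nat \<lfloor>u\<rfloor>"
  have u: "u \<ge> 0" using t pp by (simp add: u_def)
  have "t * real CARD('p) powi N = u / real_of_int (int CARD('p))"
    using pp by (simp add: u_def power_int_add field_simps)
  then have "\<lfloor>t * real CARD('p) powi N\<rfloor> = \<lfloor>u\<rfloor> div int CARD('p)"
    by (simp only: floor_divide_real_eq_div)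
  then have k: "nat \<lfloor>t * real CARD('p) powi N\<rfloor> = m div CARD('p)"
    using u by (simp add: m_def nat_div_distrib)
  define d where "d = m mod CARD('p)"
  have d: "d < CARD('p)" by (simp add: d_def)
  have m: "m = CARD('p) * (m div CARD('p)) + d" by (simp add: d_def)
  have "(padic_approx (N + 1) t :: 'p padic) = of_rat (padic_frac CARD('p) m) * of_nat CARD('p) powi (N + 1)"
    by (simp add: padic_approx_def m_def u_def)
  also have "\<dots> = (of_rat (padic_frac CARD('p) (m div CARD('p))) + of_nat d) / of_nat CARD('p)
      * of_nat CARD('p) powi (N + 1)"
    by (subst m, subst padic_frac_step[OF d]) simp
  also have "\<dots> = padic_approx N t + of_nat d * of_nat CARD('p) powi N"
    by (simp add: padic_approx_def k power_int_add field_simps)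
  finally have "padic_approx (N + 1) t - padic_approx N t = (of_nat d * of_nat CARD('p) powi N :: 'p padic)"
    by simp
  moreover have "padic_norm (of_nat d :: 'p padic) \<le> 1"
    using padic_norm_of_int_le_1[of "int d", where 'p = 'p] by simp
  ultimately show ?thesis
    using pp by (simp add: padic_norm_mult padic_norm_p_powi mult_left_le_one_le)
qed

lemma padic_approx_le:
  assumes t: "t \<ge> 0" and "N \<le> M"
  shows "padic_norm (padic_approx M t - padic_approx N t :: 'p::prime_card padic) \<le> real CARD('p) powi (- N)"
  using assms(2)
proof (induction M rule: int_ge_induct)
  case base
  have "real CARD('p) powi (- N) > 0" using padic_p_gt_1[where 'p = 'p] by simp
  then show ?case by simp
next
  case (step M)
  have "real CARD('p) powi (- M) \<le> real CARD('p) powi (- N)"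
    using step(1) padic_p_gt_1[where 'p = 'p] by (intro power_int_increasing) auto
  with padic_approx_step[OF t, of M, where 'p = 'p] step.IH show ?case
    by (meson order_trans padic_norm_diff_le)
qed

definition padic_of_real :: "real \<Rightarrow> 'p::prime_card padic" where
  "padic_of_real t = lim (\<lambda>n. padic_approx (int n) t)"

lemma padic_of_real_approx:
  assumes t: "t \<ge> 0"
  shows "padic_norm (padic_of_real t - padic_approx N t :: 'p::prime_card padic) \<le> real CARD('p) powi (- N)"
proof -
  let ?f = "\<lambda>n. padic_approx (int n) t :: 'p padic"
  have "Cauchy ?f"
  proof (rule metric_CauchyI)
    fix e :: real assume "e > 0"
    then obtain K :: nat where K: "real CARD('p) powi (- int K) < e" using padic_powi_small by blast
    have "dist (?f m) (?f n) < e" if "m \<ge> K" "n \<ge> K" for m n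
    proof -
      have "padic_norm (?f m - ?f n) \<le> real CARD('p) powi (- int K)"
        using padic_approx_le[OF t, of "int K" "int m", where 'p = 'p]
          padic_approx_le[OF t, of "int K" "int n", where 'p = 'p] that
          padic_norm_minus_commute[of "?f n" "?f K"]
        by (intro padic_norm_diff_le[of "?f m" "?f K" _ "?f n"]) auto
      then show ?thesis using K by (simp add: dist_padic_def)
    qed
    then show "\<exists>M. \<forall>m\<ge>M. \<forall>n\<ge>M. dist (?f m) (?f n) < e" by blast
  qed
  then have "?f \<longlonglongrightarrow> padic_of_real t"
    unfolding padic_of_real_def using Cauchy_convergent convergent_LIMSEQ_iff by blast
  then have L: "(\<lambda>n. dist (?f n) (padic_approx N t)) \<longlonglongrightarrow> dist (padic_of_real t) (padic_approx N t :: 'p padic)"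
    by (intro tendsto_dist tendsto_const)
  have "\<forall>\<^sub>F n in sequentially. dist (?f n) (padic_approx N t) \<le> real CARD('p) powi (- N)"
    unfolding eventually_sequentially dist_padic_def
    using padic_approx_le[OF t, where 'p = 'p] by (intro exI[of _ "nat N"]) auto
  from tendsto_upperbound[OF L this] show ?thesis by (simp add: dist_padic_def)
qed

lemma padic_of_real_vimage_ball:
  fixes a :: "'p::prime_card padic"
  obtains k :: nat where
    "padic_of_real -` padic_ball a \<gamma> \<inter> {0..} = {real k * real CARD('p) powi \<gamma> ..< real (Suc k) * real CARD('p) powi \<gamma>}"
proof -
  have pp: "real CARD('p) > 1" by (rule padic_p_gt_1)
  let ?t = "of_nat CARD('p) powi (- \<gamma>) :: 'p padic"
  have t0: "?t \<noteq> 0" by (simp add: power_int_not_zero)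
  have nt: "padic_norm ?t = real CARD('p) powi \<gamma>" by (simp only: padic_norm_p_powi minus_minus)
  have pos: "real CARD('p) powi \<gamma> > 0" using pp by simp
  obtain k where k: "padic_norm (a / ?t - of_rat (padic_frac CARD('p) k)) \<le> 1"
    using padic_frac_exists by blast
  have "padic_of_real t \<in> padic_ball a \<gamma> \<longleftrightarrow> real k * real CARD('p) powi \<gamma> \<le> t \<and> t < real (Suc k) * real CARD('p) powi \<gamma>"
    if t: "t \<ge> 0" for t
  proof -
    define l where "l = nat \<lfloor>t * real CARD('p) powi (- \<gamma>)\<rfloor>"
    let ?l = "of_rat (padic_frac CARD('p) l) :: 'p padic"
    have app: "padic_approx (- \<gamma>) t = ?l * ?t" by (simp add: padic_approx_def l_def)
    have n: "padic_norm (padic_of_real t - ?l * ?t) \<le> real CARD('p) powi \<gamma>"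
      using padic_of_real_approx[OF t, of "- \<gamma>", where 'p = 'p] app by simp
    have "padic_of_real t \<in> padic_ball a \<gamma> \<longleftrightarrow> padic_norm (?l * ?t - a) \<le> real CARD('p) powi \<gamma>"
      unfolding padic_ball_def mem_Collect_eq using n
      by (metis padic_norm_diff_le padic_norm_minus_commute)
    also have "?l * ?t - a = (?l - a / ?t) * ?t" using t0 by (simp add: field_simps)
    also have "padic_norm \<dots> \<le> real CARD('p) powi \<gamma> \<longleftrightarrow> padic_norm (?l - a / ?t) \<le> 1"
      using pos by (simp add: padic_norm_mult nt)
    also have "\<dots> \<longleftrightarrow> l = k"
    proof
      assume "padic_norm (?l - a / ?t) \<le> 1"
      from padic_norm_diff_le[OF this k] show "l = k" by (rule padic_frac_unique)
    qed (use k padic_norm_minus_commute[of ?l "a / ?t"] in auto)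
    also have "\<dots> \<longleftrightarrow> real k \<le> t / real CARD('p) powi \<gamma> \<and> t / real CARD('p) powi \<gamma> < real (Suc k)"
    proof -
      have e: "t * real CARD('p) powi (- \<gamma>) = t / real CARD('p) powi \<gamma>"
        by (simp add: power_int_minus divide_inverse)
      have "t / real CARD('p) powi \<gamma> \<ge> 0" using t pos by simp
      then have "l = k \<longleftrightarrow> \<lfloor>t / real CARD('p) powi \<gamma>\<rfloor> = int k" unfolding l_def e by auto
      then show ?thesis by (auto simp: floor_eq_iff)
    qed
    also have "\<dots> \<longleftrightarrow> real k * real CARD('p) powi \<gamma> \<le> t \<and> t < real (Suc k) * real CARD('p) powi \<gamma>"
      using pos by (simp only: pos_le_divide_eq pos_divide_less_eq)
    finally show ?thesis .
  qed
  moreover have "t \<ge> 0" if "real k * real CARD('p) powi \<gamma> \<le> t" for t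
    using that pos by (meson less_imp_le mult_nonneg_nonneg of_nat_0_le_iff order_trans)
  ultimately have "padic_of_real -` padic_ball a \<gamma> \<inter> {0..} = {real k * real CARD('p) powi \<gamma> ..< real (Suc k) * real CARD('p) powi \<gamma>}"
    by auto
  then show ?thesis by (rule that)
qed

lemma padic_haar_exists: "\<exists>M :: 'p::prime_card padic measure. is_padic_haar M"
proof -
  let ?L = "restrict_space lborel {0::real..}"
  let ?g = "padic_of_real :: real \<Rightarrow> 'p padic"
  have g: "?g \<in> ?L \<rightarrow>\<^sub>M borel"
  proof (rule measurable_sigma_sets[OF padic_sets_borel])
    fix B assume "B \<in> insert {} (range (\<lambda>(a, \<gamma>). padic_ball a \<gamma> :: 'p padic set))"
    then consider "B = {}" | a \<gamma> where "B = padic_ball a \<gamma>" by auto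
    then show "?g -` B \<inter> space ?L \<in> sets ?L"
    proof cases
      case 2
      obtain k where "?g -` B \<inter> {0..} = {real k * real CARD('p) powi \<gamma> ..< real (Suc k) * real CARD('p) powi \<gamma>}"
        unfolding 2 by (rule padic_of_real_vimage_ball)
      then have "?g -` B \<inter> space ?L \<in> sets lborel" "?g -` B \<inter> space ?L \<subseteq> {0..}"
        by (auto simp: space_restrict_space)
      then show ?thesis by (subst sets_restrict_space_iff) auto
    qed auto
  qed auto
  define M where "M = distr ?L borel ?g"
  have sM: "sets M = sets borel" by (simp add: M_def)
  have ball: "emeasure M (padic_ball a \<gamma>) = ennreal (real CARD('p) powi \<gamma>)" for a \<gamma>
  proof -
    obtain k where k: "?g -` padic_ball a \<gamma> \<inter> {0..} = {real k * real CARD('p) powi \<gamma> ..< real (Suc k) * real CARD('p) powi \<gamma>}"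
      by (rule padic_of_real_vimage_ball)
    have "emeasure M (padic_ball a \<gamma>) = emeasure ?L (?g -` padic_ball a \<gamma> \<inter> space ?L)"
      unfolding M_def by (rule emeasure_distr[OF g]) (auto intro!: borel_open open_padic_ball)
    also have "\<dots> = emeasure lborel (?g -` padic_ball a \<gamma> \<inter> {0..})"
      by (subst emeasure_restrict_space) (auto simp: space_restrict_space)
    also have "\<dots> = ennreal (real (Suc k) * real CARD('p) powi \<gamma> - real k * real CARD('p) powi \<gamma>)"
      unfolding k using padic_p_gt_1[where 'p = 'p]
      by (intro emeasure_lborel_Ico mult_right_mono) auto
    also have "real (Suc k) * real CARD('p) powi \<gamma> - real k * real CARD('p) powi \<gamma> = real CARD('p) powi \<gamma>"
      by (simp add: algebra_simps)
    finally show ?thesis .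
  qed
  have "distr M borel (\<lambda>x. a + x) = M" for a
  proof (rule padic_measure_eqI)
    have m: "(\<lambda>x. a + x) \<in> M \<rightarrow>\<^sub>M borel"
      using padic_translate_measurable[of a] sM by (simp cong: measurable_cong_sets)
    have sp: "space M = UNIV" by (simp add: M_def)
    show *: "emeasure (distr M borel (\<lambda>x. a + x)) (padic_ball b \<gamma>) = emeasure M (padic_ball b \<gamma>)" for b \<gamma>
      by (subst emeasure_distr[OF m])
         (auto simp: sp padic_ball_translate ball intro!: borel_open open_padic_ball)
    show "emeasure (distr M borel (\<lambda>x. a + x)) (padic_ball 0 (int n)) \<noteq> \<infinity>" for n :: nat
      unfolding * ball by simp
  qed (auto simp: sM)
  moreover have "emeasure M {x. padic_norm x \<le> 1} = 1"
    using ball[of 0 0] by (simp add: padic_ball_def)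
  ultimately show ?thesis using sM unfolding is_padic_haar_def by blast
qed

definition padic_haar :: "'p::prime_card padic measure" where
  "padic_haar = (THE M. is_padic_haar M)"

lemma is_padic_haar_padic_haar: "is_padic_haar (padic_haar :: 'p::prime_card padic measure)"
  unfolding padic_haar_def using padic_haar_exists padic_haar_unique by (metis theI)

definition is_padic_ball :: "'p::prime_card padic set \<Rightarrow> bool" where
  "is_padic_ball B \<longleftrightarrow> (\<exists>a \<gamma>. B = padic_ball a \<gamma>)"

definition has_padic_derivative ::
    "('p::prime_card padic \<Rightarrow> 'p padic) \<Rightarrow> 'p padic \<Rightarrow> 'p padic \<Rightarrow> bool" where
  "has_padic_derivative \<phi> D x \<longleftrightarrow> ((\<lambda>h. (\<phi> (x + h) - \<phi> x) / h) \<longlongrightarrow> D) (at 0)"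

definition padic_deriv :: "('p::prime_card padic \<Rightarrow> 'p padic) \<Rightarrow> 'p padic \<Rightarrow> 'p padic" where
  "padic_deriv \<phi> x = (THE D. has_padic_derivative \<phi> D x)"

instance padic :: (prime_card) perfect_space
proof
  fix x :: "'a padic"
  show "\<not> open {x}"
  proof
    assume "open {x}"
    then obtain e where e: "e > 0" "\<And>y. dist y x < e \<Longrightarrow> y = x"
      unfolding open_dist by blast
    obtain n :: nat where n: "real CARD('a) powi (- int n) < e"
      using padic_powi_small[OF e(1)] by blast
    have "dist (x + of_nat CARD('a) powi int n) x = real CARD('a) powi (- int n)"
      by (simp only: dist_padic_def add_diff_cancel_left' padic_norm_p_powi)
    with n have "x + of_nat CARD('a) powi int n = x" by (intro e(2)) simp
    then have "of_nat CARD('a) ^ n = (0 :: 'a padic)" by simp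
    then show False using padic_p_ne_0(1)[where 'p = 'a] power_eq_0_iff by metis
  qed
qed

lemma padic_deriv_eq:
  "has_padic_derivative \<phi> D x \<Longrightarrow> padic_deriv \<phi> x = D"
  unfolding padic_deriv_def has_padic_derivative_def
  by (intro the_equality) (auto intro: tendsto_unique[OF trivial_limit_at])

definition padic_continuously_differentiable :: "('p::prime_card padic \<Rightarrow> 'p padic) \<Rightarrow> bool" where
  "padic_continuously_differentiable \<phi> \<longleftrightarrow>
     (\<forall>x. \<exists>D. has_padic_derivative \<phi> D x) \<and> continuous_on UNIV (padic_deriv \<phi>)"

definition vladimirov_integrand ::
    "real \<Rightarrow> ('p::prime_card padic \<Rightarrow> complex) \<Rightarrow> 'p padic \<Rightarrow> 'p padic \<Rightarrow> complex" where
  "vladimirov_integrand \<alpha> f x y =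
     (f x - f y) / complex_of_real (padic_norm (x - y) powr (1 + \<alpha>))"

definition vladimirov_const :: "nat \<Rightarrow> real \<Rightarrow> real" where
  "vladimirov_const p \<alpha> = (real p powr \<alpha> - 1) / (1 - real p powr (- 1 - \<alpha>))"

text \<open>
  Integrals are taken over the completed Haar measure, so that all Haar-measurable functions are
  covered and not just the Borel measurable ones. The integrand takes the value \<open>0 / 0 = 0\<close> at
  \<open>y = x\<close>, which is a null set.
\<close>

definition vladimirov_converges ::
    "real \<Rightarrow> ('p::prime_card padic \<Rightarrow> complex) \<Rightarrow> 'p padic \<Rightarrow> bool" where
  "vladimirov_converges \<alpha> f x \<longleftrightarrow> integrable (completion padic_haar) (vladimirov_integrand \<alpha> f x)"

definition vladimirov ::
    "real \<Rightarrow> ('p::prime_card padic \<Rightarrow> complex) \<Rightarrow> 'p padic \<Rightarrow> complex" where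
  "vladimirov \<alpha> f x = complex_of_real (vladimirov_const CARD('p) \<alpha>) *
     (LINT y|completion padic_haar. vladimirov_integrand \<alpha> f x y)"

definition substitution_op :: "('a \<Rightarrow> 'a) \<Rightarrow> ('a \<Rightarrow> 'b) \<Rightarrow> 'a \<Rightarrow> 'b" where
  "substitution_op \<phi> f = (\<lambda>x. f (\<phi> x))"

end

theory Submission
  imports Defs
begin

text \<open>
  A bijection \<open>\<phi>\<close> under which images and preimages of balls are balls preserves the inclusion
  order on balls. The balls around a point \<open>x\<close> form a chain of type \<open>\<int>\<close>, which \<open>\<phi>\<close> carries
  bijectively and monotonically to the chain of balls around \<open>\<phi> x\<close>. Such a map of \<open>\<int>\<close> is a
  translation by some \<open>c\<close>, and \<open>c\<close> does not depend on \<open>x\<close>, because any two points lie in a common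
  ball. The norm takes only powers of \<open>p\<close> as nonzero values, so \<open>\<phi>\<close> is a similarity:
  \<open>\<bar>\<phi> x - \<phi> y\<bar> = p\<^sup>c \<bar>x - y\<bar>\<close> for all \<open>x\<close> and \<open>y\<close> (\<open>padic_ball_map_similarity\<close>).

  Three consequences give the theorem. The difference quotients of \<open>\<phi>\<close> have constant norm
  \<open>p\<^sup>c\<close>, hence \<open>\<bar>\<phi>'(x)\<bar> = p\<^sup>c\<close>. The integrand of \<open>D\<^sup>\<alpha>(f \<circ> \<phi>)\<close> at \<open>(x, y)\<close> is \<open>p\<close> to the power
  \<open>c (1 + \<alpha>)\<close> times the integrand of \<open>D\<^sup>\<alpha> f\<close> at \<open>(\<phi> x, \<phi> y)\<close>. Finally, \<open>\<phi>\<close> pushes the Haar measure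
  forward to its multiple by \<open>p\<close> to the power \<open>- c\<close>, since this holds on balls. The substitution
  \<open>y \<mapsto> \<phi> y\<close> thus leaves the total factor \<open>p\<close> to the power \<open>c (1 + \<alpha>) - c = c \<alpha>\<close>, which is
  \<open>\<bar>\<phi>'(x)\<bar>\<^sup>\<alpha>\<close>.
\<close>

section \<open>The value group and the radius of a ball\<close>

text \<open>
  The value group is discrete because a nonzero \<open>x\<close> has the same norm as any rational closer to \<open>x\<close>
  than \<open>0\<close> is.
\<close>
lemma padic_norm_eq_powi:
  fixes x :: "'p::prime_card padic"
  assumes "x \<noteq> 0"
  obtains n where "padic_norm x = real CARD('p) powi n"
proof -
  have "padic_norm x > 0" using assms by (simp add: less_le)
  then obtain q where "dist x (of_rat q) < padic_norm x" by (rule padic_rat_dense)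
  then have d: "padic_norm (x - of_rat q) < padic_norm x" by (simp add: dist_padic_def)
  have "padic_norm x \<le> max (padic_norm (x - of_rat q)) (padic_norm (of_rat q :: 'p padic))"
    using padic_norm_add_le_max[of "x - of_rat q" "of_rat q"] by simp
  moreover have "padic_norm (of_rat q :: 'p padic) \<le> max (padic_norm (of_rat q - x)) (padic_norm x)"
    using padic_norm_add_le_max[of "of_rat q - x" x] by simp
  ultimately have eq: "padic_norm x = padic_norm (of_rat q :: 'p padic)"
    using d by (simp add: padic_norm_minus_commute[of _ x] max_def split: if_splits)
  then have "q \<noteq> 0" using assms by (auto simp flip: padic_norm_eq_0_iff)
  then show ?thesis using that eq by (simp add: padic_norm_of_rat padic_abs_def)
qed

lemma powi_le_powi_iff:
  fixes b :: real
  assumes "b > 1"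
  shows "b powi m \<le> b powi n \<longleftrightarrow> m \<le> n"
  using assms power_int_increasing[of m n b] power_int_strict_increasing[of n m b]
  by (meson less_imp_le not_le)

text \<open>
  The norm of a point is determined by the balls around \<open>0\<close> that contain it. This uses the discrete
  value group: thresholds at powers of \<open>p\<close> cannot separate arbitrary reals.
\<close>
lemma padic_norm_le_powi_eqI:
  fixes x :: "'p::prime_card padic"
  assumes iff: "\<And>\<gamma>. padic_norm x \<le> real CARD('p) powi (\<gamma> + c) \<longleftrightarrow> padic_norm y \<le> real CARD('p) powi \<gamma>"
  shows "padic_norm x = real CARD('p) powi c * padic_norm (y :: 'p padic)"
proof -
  have p: "real CARD('p) > 1" by (rule padic_p_gt_1)
  have zero: "z = 0" if "\<And>\<gamma>. padic_norm z \<le> real CARD('p) powi \<gamma>" for z :: "'p padic"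
  proof (rule ccontr)
    assume "z \<noteq> 0"
    then have "padic_norm z > 0" by (simp add: less_le)
    then obtain n :: nat where "real CARD('p) powi (- int n) < padic_norm z"
      by (rule padic_powi_small)
    with that[of "- int n"] show False by simp
  qed
  show ?thesis
  proof (cases "x = 0 \<or> y = 0")
    case True
    have "x = 0" if "y = 0"
    proof (rule zero)
      show "padic_norm x \<le> real CARD('p) powi \<gamma>" for \<gamma>
        using iff[of "\<gamma> - c"] that p by simp
    qed
    moreover have "y = 0" if "x = 0"
    proof (rule zero)
      show "padic_norm y \<le> real CARD('p) powi \<gamma>" for \<gamma>
        using iff[of \<gamma>] that p by simp
    qed
    ultimately show ?thesis using True by auto
  next
    case False
    obtain m where m: "padic_norm x = real CARD('p) powi m" using False padic_norm_eq_powi by blast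
    obtain n where n: "padic_norm y = real CARD('p) powi n" using False padic_norm_eq_powi by blast
    have "m \<le> \<gamma> + c \<longleftrightarrow> n \<le> \<gamma>" for \<gamma>
      using iff[of \<gamma>] unfolding m n powi_le_powi_iff[OF p] .
    from this[of n] this[of "m - c"] have "m = c + n" by simp
    then show ?thesis using p by (simp add: m n power_int_add)
  qed
qed

text \<open>Balls of different radius differ because their Haar measures do.\<close>
lemma padic_ball_subset_iff:
  "padic_ball (a :: 'p::prime_card padic) \<gamma> \<subseteq> padic_ball a \<delta> \<longleftrightarrow> \<gamma> \<le> \<delta>"
proof
  assume sub: "padic_ball a \<gamma> \<subseteq> padic_ball a \<delta>"
  have H: "is_padic_haar (padic_haar :: 'p padic measure)" by (rule is_padic_haar_padic_haar)
  have "emeasure padic_haar (padic_ball a \<gamma>) \<le> emeasure padic_haar (padic_ball a \<delta>)"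
    using H by (intro emeasure_mono[OF sub]) (simp add: is_padic_haar_def open_padic_ball)
  then show "\<gamma> \<le> \<delta>"
    using padic_p_gt_1[where 'p = 'p]
    by (simp add: padic_haar_ball[OF H] powi_le_powi_iff[OF padic_p_gt_1])
qed (rule padic_ball_mono)

lemma centre_in_padic_ball [simp]: "a \<in> padic_ball (a :: 'p::prime_card padic) \<gamma>"
  using padic_p_gt_1[where 'p = 'p] by (simp add: padic_ball_def)

lemma is_padic_ball_centreE:
  assumes "is_padic_ball B" "x \<in> (B :: 'p::prime_card padic set)"
  obtains \<gamma> where "B = padic_ball x \<gamma>"
  using assms padic_ball_eq unfolding is_padic_ball_def by metis

section \<open>Ball-preserving bijections are similarities\<close>

lemma int_strict_mono_surj_translation:
  fixes r :: "int \<Rightarrow> int"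
  assumes mono: "strict_mono r" and surj: "surj r"
  shows "r n = n + r 0"
proof -
  have step: "r (n + 1) = r n + 1" for n
  proof -
    obtain m where m: "r m = r n + 1" using surj by (metis surjD)
    then have "n < m" using strict_mono_less[OF mono, of n m] by simp
    then have "r (n + 1) \<le> r m" by (simp add: strict_mono_less_eq[OF mono])
    moreover have "r n < r (n + 1)" by (simp add: strict_mono_less[OF mono])
    ultimately show ?thesis using m by linarith
  qed
  show ?thesis
  proof (induction n rule: int_induct[where k = 0])
    case (step2 i)
    then show ?case using step[of "i - 1"] by simp
  qed (simp_all add: step)
qed

text \<open>
  At each point the chain of balls is shifted; comparing two points on a ball that contains both
  shows that the shift is the same everywhere.
\<close>
lemma padic_ball_map_shift:
  fixes \<phi> :: "'p::prime_card padic \<Rightarrow> 'p padic"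
  assumes bij: "bij \<phi>"
    and image: "\<And>B. is_padic_ball B \<Longrightarrow> is_padic_ball (\<phi> ` B)"
    and vimage: "\<And>B. is_padic_ball B \<Longrightarrow> is_padic_ball (\<phi> -` B)"
  obtains c where "\<And>x \<gamma>. \<phi> ` padic_ball x \<gamma> = padic_ball (\<phi> x) (\<gamma> + c)"
proof -
  have local_shift: "\<exists>c. \<forall>\<gamma>. \<phi> ` padic_ball x \<gamma> = padic_ball (\<phi> x) (\<gamma> + c)" for x
  proof -
    have "\<exists>\<delta>. \<phi> ` padic_ball x \<gamma> = padic_ball (\<phi> x) \<delta>" for \<gamma>
      by (rule is_padic_ball_centreE[OF image, of "padic_ball x \<gamma>" "\<phi> x"])
        (auto simp: is_padic_ball_def)
    then obtain r where r: "\<And>\<gamma>. \<phi> ` padic_ball x \<gamma> = padic_ball (\<phi> x) (r \<gamma>)" by metis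
    have le: "r \<gamma> \<le> r \<delta> \<longleftrightarrow> \<gamma> \<le> \<delta>" for \<gamma> \<delta>
      using inj_image_subset_iff[OF bij_is_inj[OF bij], of "padic_ball x \<gamma>" "padic_ball x \<delta>"]
      by (simp add: r padic_ball_subset_iff)
    have "strict_mono r" by (rule strict_monoI) (simp add: le flip: not_le)
    moreover have "surj r"
    proof -
      have "\<exists>\<gamma>. \<delta> = r \<gamma>" for \<delta>
      proof -
        obtain \<gamma> where "\<phi> -` padic_ball (\<phi> x) \<delta> = padic_ball x \<gamma>"
          by (rule is_padic_ball_centreE[OF vimage, of "padic_ball (\<phi> x) \<delta>" x])
            (auto simp: is_padic_ball_def)
        then have "padic_ball (\<phi> x) \<delta> = padic_ball (\<phi> x) (r \<gamma>)"
          using surj_image_vimage_eq[OF bij_is_surj[OF bij]] by (metis r)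
        then show ?thesis by (metis antisym order_refl padic_ball_subset_iff)
      qed
      then show ?thesis by (simp add: surj_def)
    qed
    ultimately have "r \<gamma> = \<gamma> + r 0" for \<gamma> by (rule int_strict_mono_surj_translation)
    then show ?thesis using r by metis
  qed
  then obtain C where C: "\<And>x \<gamma>. \<phi> ` padic_ball x \<gamma> = padic_ball (\<phi> x) (\<gamma> + C x)" by metis
  have "C x = C 0" for x
  proof -
    obtain n :: nat where "padic_norm x < real CARD('p) powi (int n)" by (rule padic_powi_large)
    then have x: "x \<in> padic_ball 0 (int n)" by (simp add: padic_ball_def del: power_int_of_nat)
    then have "\<phi> x \<in> padic_ball (\<phi> 0) (int n + C 0)" by (simp flip: C)
    then have "padic_ball (\<phi> x) (int n + C x) = padic_ball (\<phi> x) (int n + C 0)"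
      by (metis C padic_ball_eq x)
    then show ?thesis by (metis add_left_cancel antisym order_refl padic_ball_subset_iff)
  qed
  then show ?thesis using C that by metis
qed

lemma padic_ball_map_similarity:
  fixes \<phi> :: "'p::prime_card padic \<Rightarrow> 'p padic"
  assumes bij: "bij \<phi>"
    and image: "\<And>B. is_padic_ball B \<Longrightarrow> is_padic_ball (\<phi> ` B)"
    and vimage: "\<And>B. is_padic_ball B \<Longrightarrow> is_padic_ball (\<phi> -` B)"
  obtains c where "\<And>x y. padic_norm (\<phi> x - \<phi> y) = real CARD('p) powi c * padic_norm (x - y)"
proof -
  obtain c where c: "\<And>x \<gamma>. \<phi> ` padic_ball x \<gamma> = padic_ball (\<phi> x) (\<gamma> + c)"
    using padic_ball_map_shift[OF bij image vimage] by blast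
  have "padic_norm (\<phi> x - \<phi> y) \<le> real CARD('p) powi (\<gamma> + c) \<longleftrightarrow> padic_norm (x - y) \<le> real CARD('p) powi \<gamma>"
    for x y \<gamma>
  proof -
    have "\<phi> x \<in> \<phi> ` padic_ball y \<gamma> \<longleftrightarrow> x \<in> padic_ball y \<gamma>"
      by (rule inj_image_mem_iff[OF bij_is_inj[OF bij]])
    then show ?thesis unfolding c by (simp add: padic_ball_def)
  qed
  then have "padic_norm (\<phi> x - \<phi> y) = real CARD('p) powi c * padic_norm (x - y)" for x y
    by (rule padic_norm_le_powi_eqI)
  then show ?thesis by (rule that)
qed

section \<open>Derivative and Haar measure under a similarity\<close>

lemma padic_deriv_norm_similarity:
  fixes \<phi> :: "'p::prime_card padic \<Rightarrow> 'p padic"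
  assumes sim: "\<And>x y. padic_norm (\<phi> x - \<phi> y) = L * padic_norm (x - y)"
    and D: "has_padic_derivative \<phi> D x"
  shows "padic_norm (padic_deriv \<phi> x) = L"
proof -
  have "((\<lambda>h. dist ((\<phi> (x + h) - \<phi> x) / h) 0) \<longlongrightarrow> dist D 0) (at 0)"
    using D unfolding has_padic_derivative_def by (intro tendsto_dist tendsto_const)
  moreover have "\<forall>\<^sub>F h in at 0. dist ((\<phi> (x + h) - \<phi> x) / h) 0 = L"
    unfolding eventually_at_filter
    by (rule always_eventually) (simp add: dist_padic_def padic_norm_divide sim)
  ultimately have "((\<lambda>h :: 'p padic. L) \<longlongrightarrow> dist D 0) (at 0)"
    by (simp add: tendsto_cong)
  then have "dist D 0 = L"
    by (intro tendsto_unique[OF trivial_limit_at _ tendsto_const])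
  then show ?thesis by (simp add: padic_deriv_eq[OF D] dist_padic_def)
qed

lemma padic_similarity_measurable:
  fixes \<phi> :: "'p::prime_card padic \<Rightarrow> 'p padic"
  assumes sim: "\<And>x y. padic_norm (\<phi> x - \<phi> y) = L * padic_norm (x - y)"
  shows "\<phi> \<in> borel \<rightarrow>\<^sub>M borel"
proof (rule borel_measurable_continuous_onI)
  have "L-lipschitz_on UNIV \<phi>"
  proof (rule lipschitz_onI)
    show "dist (\<phi> x) (\<phi> y) \<le> L * dist x y" for x y
      by (simp add: dist_padic_def sim)
    show "0 \<le> L" using sim[of 1 0] by (metis diff_zero mult.right_neutral padic_norm_1 padic_norm_nonneg)
  qed
  then show "continuous_on UNIV \<phi>" by (rule lipschitz_on_continuous_on)
qed

text \<open>The preimage of a ball is a ball whose radius is divided by \<open>p\<^sup>c\<close>, and the measure of a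
  ball equals its radius.\<close>
lemma padic_similarity_distr_haar:
  fixes \<phi> :: "'p::prime_card padic \<Rightarrow> 'p padic"
  assumes surj: "surj \<phi>"
    and sim: "\<And>x y. padic_norm (\<phi> x - \<phi> y) = real CARD('p) powi c * padic_norm (x - y)"
  shows "distr padic_haar padic_haar \<phi> = density padic_haar (\<lambda>_. ennreal (real CARD('p) powi (- c)))"
proof (rule padic_measure_eqI)
  let ?H = "padic_haar :: 'p padic measure"
  have p: "real CARD('p) > 1" by (rule padic_p_gt_1)
  have H: "is_padic_haar ?H" by (rule is_padic_haar_padic_haar)
  then have s [measurable_cong]: "sets ?H = sets borel" by (simp add: is_padic_haar_def)
  then show "sets (distr ?H ?H \<phi>) = sets borel"
    "sets (density ?H (\<lambda>_. ennreal (real CARD('p) powi (- c)))) = sets borel" by simp_all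
  have [measurable]: "\<phi> \<in> ?H \<rightarrow>\<^sub>M ?H"
    using padic_similarity_measurable[OF sim] by (simp cong: measurable_cong_sets add: s)
  have ball [measurable]: "padic_ball a \<gamma> \<in> sets ?H" for a \<gamma> by (simp add: s open_padic_ball)
  have sp: "space ?H = UNIV" using sets_eq_imp_space_eq[OF s] by simp
  have vimage: "\<phi> -` padic_ball (\<phi> b) \<gamma> = padic_ball b (\<gamma> - c)" for b \<gamma>
    using p by (auto simp: padic_ball_def sim power_int_diff field_simps)
  have distr: "emeasure (distr ?H ?H \<phi>) (padic_ball a \<gamma>) = ennreal (real CARD('p) powi (\<gamma> - c))" for a \<gamma>
  proof -
    obtain b where "a = \<phi> b" using surj by (metis surjD)
    then show ?thesis by (simp add: emeasure_distr sp vimage padic_haar_ball[OF H])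
  qed
  show "emeasure (distr ?H ?H \<phi>) (padic_ball 0 (int n)) \<noteq> \<infinity>" for n
    by (simp add: distr)
  show "emeasure (distr ?H ?H \<phi>) (padic_ball a \<gamma>)
      = emeasure (density ?H (\<lambda>_. ennreal (real CARD('p) powi (- c)))) (padic_ball a \<gamma>)" for a \<gamma>
    using p by (simp add: distr emeasure_density_const padic_haar_ball[OF H] power_int_diff
        power_int_minus field_simps flip: ennreal_mult)
qed

lemma padic_similarity_integral:
  fixes \<phi> :: "'p::prime_card padic \<Rightarrow> 'p padic"
    and g :: "'p padic \<Rightarrow> 'b::{banach, second_countable_topology}"
  assumes surj: "surj \<phi>"
    and sim: "\<And>x y. padic_norm (\<phi> x - \<phi> y) = real CARD('p) powi c * padic_norm (x - y)"
    and g: "g \<in> borel_measurable (completion padic_haar)"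
  shows "(LINT y|completion padic_haar. g (\<phi> y))
    = real CARD('p) powi (- c) *\<^sub>R (LINT y|completion padic_haar. g y)"
proof -
  let ?H = "padic_haar :: 'p padic measure"
  let ?k = "real CARD('p) powi (- c)"
  have k: "?k > 0" using padic_p_gt_1[where 'p = 'p] by simp
  have s: "sets ?H = sets borel"
    using is_padic_haar_padic_haar[where 'p = 'p] by (simp add: is_padic_haar_def)
  have m: "\<phi> \<in> ?H \<rightarrow>\<^sub>M ?H"
    using padic_similarity_measurable[OF sim] by (simp cong: measurable_cong_sets add: s)
  have distr: "distr (completion ?H) ?H \<phi> = density ?H (\<lambda>_. ennreal ?k)"
    by (simp add: distr_completion m padic_similarity_distr_haar[OF surj sim])
  \<comment> \<open>The density is positive, so \<open>\<phi>\<close> respects null sets and the push-forward passes to completions.\<close>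
  have null: "null_sets (distr (completion ?H) ?H \<phi>) = null_sets ?H"
    unfolding distr using k by (auto simp: null_sets_def emeasure_density_const )
  have m': "\<phi> \<in> completion ?H \<rightarrow>\<^sub>M completion ?H"
    using m null by (intro completion.measurable_completion2) (auto intro: measurable_completion)
  have "distr (completion ?H) (completion ?H) \<phi> = completion (distr (completion ?H) ?H \<phi>)"
    by (rule completion.completion_distr_eq[symmetric]) (use m null in \<open>auto intro: measurable_completion\<close>)
  also have "\<dots> = density (completion ?H) (\<lambda>_. ennreal ?k)"
    unfolding distr by (rule completion_density_eq) (use k in auto)
  finally have eq: "distr (completion ?H) (completion ?H) \<phi> = density (completion ?H) (\<lambda>_. ennreal ?k)" .
  have "(LINT y|completion ?H. g (\<phi> y)) = (LINT y|distr (completion ?H) (completion ?H) \<phi>. g y)"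
    by (rule integral_distr[OF m' g, symmetric])
  also have "\<dots> = (LINT y|completion ?H. ?k *\<^sub>R g y)"
    unfolding eq by (rule integral_density[OF g]) (use k in auto)
  finally show ?thesis by simp
qed

section \<open>Change of variables in the Vladimirov operator\<close>

theorem mainTheorem1:
  fixes \<phi> :: "'p::prime_card padic \<Rightarrow> 'p padic"
    and f :: "'p padic \<Rightarrow> complex"
    and \<alpha> :: real
    and x :: "'p padic"
  assumes "bij \<phi>"
    and "\<And>B. is_padic_ball B \<Longrightarrow> is_padic_ball (\<phi> ` B)"
    and "\<And>B. is_padic_ball B \<Longrightarrow> is_padic_ball (\<phi> -` B)"
    and "padic_continuously_differentiable \<phi>"
    and "\<alpha> > 0"
    and "vladimirov_converges \<alpha> (substitution_op \<phi> f) x"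
    and "vladimirov_converges \<alpha> f (\<phi> x)"
  shows "vladimirov \<alpha> (substitution_op \<phi> f) x
           = complex_of_real (padic_norm (padic_deriv \<phi> x) powr \<alpha>)
               * substitution_op \<phi> (vladimirov \<alpha> f) x
       \<and> complex_of_real (padic_norm (padic_deriv \<phi> x) powr \<alpha>)
               * substitution_op \<phi> (vladimirov \<alpha> f) x
           = complex_of_real (padic_norm (padic_deriv \<phi> x) powr \<alpha>) * vladimirov \<alpha> f (\<phi> x)"
proof -
  let ?p = "real CARD('p)"
  have p: "?p > 1" by (rule padic_p_gt_1)
  obtain c where sim: "\<And>x y. padic_norm (\<phi> x - \<phi> y) = ?p powi c * padic_norm (x - y)"
    using padic_ball_map_similarity[OF assms(1-3)] by blast
  obtain D where "has_padic_derivative \<phi> D x"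
    using assms(4) unfolding padic_continuously_differentiable_def by blast
  then have deriv: "padic_norm (padic_deriv \<phi> x) = ?p powi c"
    by (rule padic_deriv_norm_similarity[OF sim])
  let ?g = "vladimirov_integrand \<alpha> f (\<phi> x)"
  have "vladimirov_integrand \<alpha> (substitution_op \<phi> f) x y
      = complex_of_real ((?p powi c) powr (1 + \<alpha>)) * ?g (\<phi> y)" for y
    using p by (simp add: vladimirov_integrand_def substitution_op_def sim powr_mult)
  then have "(LINT y|completion padic_haar. vladimirov_integrand \<alpha> (substitution_op \<phi> f) x y)
      = complex_of_real ((?p powi c) powr (1 + \<alpha>)) * (LINT y|completion padic_haar. ?g (\<phi> y))"
    by simp
  also have "(LINT y|completion padic_haar. ?g (\<phi> y))
      = ?p powi (- c) *\<^sub>R (LINT y|completion padic_haar. ?g y)"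
    using assms(7) unfolding vladimirov_converges_def
    by (intro padic_similarity_integral[OF bij_is_surj[OF assms(1)] sim] borel_measurable_integrable)
  also have "complex_of_real ((?p powi c) powr (1 + \<alpha>)) * \<dots>
      = complex_of_real ((?p powi c) powr \<alpha>) * (LINT y|completion padic_haar. ?g y)"
    using p by (simp add: powr_add power_int_minus scaleR_conv_of_real)
  finally show ?thesis
    by (simp add: vladimirov_def substitution_op_def deriv)
qed

end
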